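(* There is an algorithm on a random access machine which, given $n\in\mathbb{N}$ with $n\ge1$ and $X\in\mathrm{IS}$ with $\mathrm{len}(X)=L(n)$, decides whether $X$ computes $\mathrm{tstnz}_n$ in time $O(n^2)$.
   Context: Basic instructions: $\mathtt{in}{:}i.\mathtt{get}$ ($i\ge1$), $\mathtt{out}.\mathtt{set}{:}b$ ($b\in\{0,1\}$), $\mathtt{aux}{:}i.\mathtt{get}$ ($i\ge1$), $\mathtt{aux}{:}i.\mathtt{set}{:}b$ ($i\ge1$, $b\in\{0,1\}$). The part before the dot names a Boolean register ($\mathtt{in}{:}i$ input, $\mathtt{out}$ output, $\mathtt{aux}{:}i$ auxiliary); $\mathtt{get}$ changes nothing and replies the content, $\mathtt{set}{:}b$ makes the content $b$ and replies $b$. Primitive instructions: for each basic instruction $a$, plain $a$, positive test $+a$, negative test $-a$; forward jumps $\#l$ ($l\in\mathbb{N}$); termination $!$. $\mathrm{IS}$ is the set of finite sequences $X=u_1;\dots;u_k$ of primitive instructions, $\mathrm{len}(X)=k$. Execution starts at $u_1$: plain $a$ executes $a$ and proceeds with the next instruction; $+a$ executes $a$ and proceeds with the next instruction if the reply is $1$, otherwise skips the next one and proceeds with the one after it; $-a$ likewise with replies reversed; $\#l$ proceeds with the $l$-th next instruction; $!$ terminates. If $l=0$ or there is no instruction to proceed with, execution never terminates. For $f:\{0,1\}^n\to\{0,1\}$, $X$ computes $f$ if there is $k$ such that for all $b_1,\dots,b_n$, executing $X$ with $\mathtt{in}{:}i$ initially $b_i$, $\mathtt{out}$ and $\mathtt{aux}{:}1,\dots,\mathtt{aux}{:}k$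 initially $0$ (other registers arbitrary) terminates with final content of $\mathtt{out}$ equal to $f(b_1,\dots,b_n)$. $\mathrm{tstnz}_n(b_1,\dots,b_n)=1$ iff some $b_i=1$. $L(n)=3n/2+1$ for even $n$, $3(n+1)/2$ for odd $n$. Model: random access machine in the sense of Cook and Reckhow (without multiplication/division), uniform cost criterion; each primitive instruction of the input is represented by two integers (its form and its natural-number parameter, or $-1$ if none). *)

theory Defs
  imports Complex_Main "HOL-Library.Landau_Symbols"
begin

section \<open>Instruction sequences\<close>

datatype basic =
    InGet nat
  | OutSet bool
  | AuxGet nat
  | AuxSet nat bool

datatype prim =
    Plain basic
  | PosTest basic
  | NegTest basic
  | Jump nat
  | Term

text \<open>Input and auxiliary registers are numbered from 1.\<close>

fun valid_basic :: "basic \<Rightarrow> bool" where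
  "valid_basic (InGet i) = (1 \<le> i)"
| "valid_basic (OutSet b) = True"
| "valid_basic (AuxGet i) = (1 \<le> i)"
| "valid_basic (AuxSet i b) = (1 \<le> i)"

fun valid_prim :: "prim \<Rightarrow> bool" where
  "valid_prim (Plain a) = valid_basic a"
| "valid_prim (PosTest a) = valid_basic a"
| "valid_prim (NegTest a) = valid_basic a"
| "valid_prim (Jump l) = True"
| "valid_prim Term = True"

definition IS :: "prim list set" where
  "IS = {X. X \<noteq> [] \<and> (\<forall>u \<in> set X. valid_prim u)}"

datatype reg = InReg nat | OutReg | AuxReg nat

type_synonym store = "reg \<Rightarrow> bool"

fun reply :: "basic \<Rightarrow> store \<Rightarrow> bool" where
  "reply (InGet i) s = s (InReg i)"
| "reply (OutSet b) s = b"
| "reply (AuxGet i) s = s (AuxReg i)"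
| "reply (AuxSet i b) s = b"

fun effect :: "basic \<Rightarrow> store \<Rightarrow> store" where
  "effect (InGet i) s = s"
| "effect (OutSet b) s = s(OutReg := b)"
| "effect (AuxGet i) s = s"
| "effect (AuxSet i b) s = s(AuxReg i := b)"

text \<open>\<open>exec X p s s'\<close>: execution of \<open>X\<close> from the instruction at position \<open>p\<close>
  (counted from 0) in store \<open>s\<close> terminates with final store \<open>s'\<close>. There is no rule for
  a position outside \<open>X\<close>, and \<open>Jump 0\<close> only leads back to itself, so in these two cases
  there is no terminating execution.\<close>

inductive exec :: "prim list \<Rightarrow> nat \<Rightarrow> store \<Rightarrow> store \<Rightarrow> bool" for X where
  exec_Term: "\<lbrakk>p < length X; X ! p = Term\<rbrakk> \<Longrightarrow> exec X p s s"
| exec_Plain: "\<lbrakk>p < length X; X ! p = Plain a; exec X (p + 1) (effect a s) s'\<rbrakk>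
    \<Longrightarrow> exec X p s s'"
| exec_PosTest: "\<lbrakk>p < length X; X ! p = PosTest a;
    exec X (if reply a s then p + 1 else p + 2) (effect a s) s'\<rbrakk> \<Longrightarrow> exec X p s s'"
| exec_NegTest: "\<lbrakk>p < length X; X ! p = NegTest a;
    exec X (if reply a s then p + 2 else p + 1) (effect a s) s'\<rbrakk> \<Longrightarrow> exec X p s s'"
| exec_Jump: "\<lbrakk>p < length X; X ! p = Jump l; exec X (p + l) s s'\<rbrakk> \<Longrightarrow> exec X p s s'"

text \<open>A function on \<open>{0,1}\<^sup>n\<close> is given by its values on Boolean lists of length \<open>n\<close>;
  the element at list position \<open>i - 1\<close> is the argument \<open>b\<^sub>i\<close>.\<close>

definition computes :: "prim list \<Rightarrow> nat \<Rightarrow> (bool list \<Rightarrow> bool) \<Rightarrow> bool" where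
  "computes X n f \<longleftrightarrow>
    (\<exists>k. \<forall>bs s. length bs = n \<and> (\<forall>i \<in> {1..n}. s (InReg i) = bs ! (i - 1)) \<and>
       s OutReg = False \<and> (\<forall>i \<in> {1..k}. s (AuxReg i) = False) \<longrightarrow>
       (\<exists>s'. exec X 0 s s' \<and> s' OutReg = f bs))"

definition tstnz :: "bool list \<Rightarrow> bool" where
  "tstnz bs \<longleftrightarrow> (\<exists>b \<in> set bs. b = True)"

definition L :: "nat \<Rightarrow> nat" where
  "L n = (if even n then 3 * n div 2 + 1 else 3 * (n + 1) div 2)"


section \<open>Random access machines\<close>

text \<open>The instruction set of Cook and Reckhow: \<open>X\<^sub>i \<leftarrow> C\<close>, \<open>X\<^sub>i \<leftarrow> X\<^sub>j + X\<^sub>k\<close>,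
  \<open>X\<^sub>i \<leftarrow> X\<^sub>j - X\<^sub>k\<close>, \<open>X\<^sub>i \<leftarrow> X\<^bsub>X\<^sub>j\<^esub>\<close>, \<open>X\<^bsub>X\<^sub>i\<^esub> \<leftarrow> X\<^sub>j\<close>, \<open>TRA m if X\<^sub>j > 0\<close>,
  \<open>READ X\<^sub>i\<close>, \<open>PRINT X\<^sub>i\<close>.\<close>

datatype ram_instr =
    RConst nat int
  | RAdd nat nat nat
  | RSub nat nat nat
  | RLoad nat nat
  | RStore nat nat
  | RTra nat nat
  | RRead nat
  | RPrint nat

type_synonym ram_program = "ram_instr list"

record ram_config =
  ram_pc :: nat
  ram_mem :: "nat \<Rightarrow> int"
  ram_inp :: "int list"
  ram_out :: "int list"

text \<open>Effect of one instruction, in particular on the program counter (lines are counted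
  from 0). The result \<open>None\<close> means that the instruction cannot be executed: a
  negative register address, or no input left to read.\<close>

fun ram_exec :: "ram_instr \<Rightarrow> ram_config \<Rightarrow> ram_config option" where
  "ram_exec (RConst i c) \<sigma> =
     Some (\<sigma>\<lparr>ram_pc := ram_pc \<sigma> + 1, ram_mem := (ram_mem \<sigma>)(i := c)\<rparr>)"
| "ram_exec (RAdd i j k) \<sigma> =
     Some (\<sigma>\<lparr>ram_pc := ram_pc \<sigma> + 1,
             ram_mem := (ram_mem \<sigma>)(i := ram_mem \<sigma> j + ram_mem \<sigma> k)\<rparr>)"
| "ram_exec (RSub i j k) \<sigma> =
     Some (\<sigma>\<lparr>ram_pc := ram_pc \<sigma> + 1,
             ram_mem := (ram_mem \<sigma>)(i := ram_mem \<sigma> j - ram_mem \<sigma> k)\<rparr>)"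
| "ram_exec (RLoad i j) \<sigma> =
     (if ram_mem \<sigma> j < 0 then None
      else Some (\<sigma>\<lparr>ram_pc := ram_pc \<sigma> + 1,
                   ram_mem := (ram_mem \<sigma>)(i := ram_mem \<sigma> (nat (ram_mem \<sigma> j)))\<rparr>))"
| "ram_exec (RStore i j) \<sigma> =
     (if ram_mem \<sigma> i < 0 then None
      else Some (\<sigma>\<lparr>ram_pc := ram_pc \<sigma> + 1,
                   ram_mem := (ram_mem \<sigma>)(nat (ram_mem \<sigma> i) := ram_mem \<sigma> j)\<rparr>))"
| "ram_exec (RTra m j) \<sigma> =
     Some (\<sigma>\<lparr>ram_pc := (if ram_mem \<sigma> j > 0 then m else ram_pc \<sigma> + 1)\<rparr>)"
| "ram_exec (RRead i) \<sigma> =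
     (case ram_inp \<sigma> of
        [] \<Rightarrow> None
      | x # xs \<Rightarrow> Some (\<sigma>\<lparr>ram_pc := ram_pc \<sigma> + 1,
                          ram_mem := (ram_mem \<sigma>)(i := x), ram_inp := xs\<rparr>))"
| "ram_exec (RPrint i) \<sigma> =
     Some (\<sigma>\<lparr>ram_pc := ram_pc \<sigma> + 1, ram_out := ram_out \<sigma> @ [ram_mem \<sigma> i]\<rparr>)"

definition ram_step :: "ram_program \<Rightarrow> ram_config \<Rightarrow> ram_config option" where
  "ram_step P \<sigma> = (if ram_pc \<sigma> < length P then ram_exec (P ! ram_pc \<sigma>) \<sigma> else None)"

fun ram_steps :: "ram_program \<Rightarrow> nat \<Rightarrow> ram_config \<Rightarrow> ram_config option" where
  "ram_steps P 0 \<sigma> = Some \<sigma>"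
| "ram_steps P (Suc t) \<sigma> = Option.bind (ram_step P \<sigma>) (ram_steps P t)"

definition ram_init :: "int list \<Rightarrow> ram_config" where
  "ram_init xs = \<lparr>ram_pc = 0, ram_mem = (\<lambda>_. 0), ram_inp = xs, ram_out = []\<rparr>"

text \<open>Time is the number of executed instructions (uniform cost criterion). A machine
  halts when control reaches a line that is not in the program; getting stuck at an
  instruction that cannot be executed is not halting.\<close>

definition ram_outputs_in_time ::
  "ram_program \<Rightarrow> int list \<Rightarrow> nat \<Rightarrow> int list \<Rightarrow> bool" where
  "ram_outputs_in_time P xs T ys \<longleftrightarrow>
    (\<exists>t \<sigma>. t \<le> T \<and> ram_steps P t (ram_init xs) = Some \<sigma> \<and>
       length P \<le> ram_pc \<sigma> \<and> ram_out \<sigma> = ys)"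


section \<open>Representation of the input\<close>

text \<open>The form of an instruction is everything but its natural-number parameter; in
  particular the Boolean of a set instruction belongs to the form.\<close>

fun basic_form :: "basic \<Rightarrow> int" where
  "basic_form (InGet i) = 0"
| "basic_form (OutSet b) = (if b then 2 else 1)"
| "basic_form (AuxGet i) = 3"
| "basic_form (AuxSet i b) = (if b then 5 else 4)"

fun basic_param :: "basic \<Rightarrow> int" where
  "basic_param (InGet i) = int i"
| "basic_param (OutSet b) = - 1"
| "basic_param (AuxGet i) = int i"
| "basic_param (AuxSet i b) = int i"

fun prim_form :: "prim \<Rightarrow> int" where
  "prim_form (Plain a) = basic_form a"
| "prim_form (PosTest a) = 6 + basic_form a"
| "prim_form (NegTest a) = 12 + basic_form a"
| "prim_form (Jump l) = 18"
| "prim_form Term = 19"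

fun prim_param :: "prim \<Rightarrow> int" where
  "prim_param (Plain a) = basic_param a"
| "prim_param (PosTest a) = basic_param a"
| "prim_param (NegTest a) = basic_param a"
| "prim_param (Jump l) = int l"
| "prim_param Term = - 1"

definition encode_input :: "nat \<Rightarrow> prim list \<Rightarrow> int list" where
  "encode_input n X = int n # concat (map (\<lambda>u. [prim_form u, prim_param u]) X)"

end

theory Submission
  imports Defs
begin

text \<open>For \<open>X\<close> of length \<open>L n\<close> it suffices to run \<open>X\<close> on \<open>O(n)\<close> inputs; each run takes \<open>O(n)\<close> steps
  because all jumps are forward.

  Suppose that \<open>X\<close> is correct on the zero vector and on the unit vectors. On the zero vector every
  input has a decisive test, and the branch taken on 1 requires a further instruction; two tests can
  share one only in the form \<open>-in:a; +in:b; e\<close>. Counting shows that length \<open>L n\<close> leaves no freedom: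
  \<open>X\<close> consists of such blocks, of one shorter block \<open>+in:a; e\<close> if \<open>n\<close> is odd, and of a final \<open>!\<close>.
  Correctness on the unit vectors makes every \<open>e\<close> set the output register to 1 or jump to a later
  \<open>e\<close>, with one exception: the \<open>e\<close> in front of the short block may be a test that skips to the \<open>e\<close>
  of the short block. If it is \<open>+in:c\<close>, the unit vectors do not suffice, but adding the sums of the
  unit vectors with the \<open>c\<close>-th one does.\<close>

section \<open>Execution of instruction sequences\<close>

lemma L_eq: "L n = n + (n + 1) div 2 + 1"
  unfolding L_def by (cases "even n") (auto elim!: evenE oddE)

fun next_state :: "prim \<Rightarrow> nat \<times> store \<Rightarrow> nat \<times> store" where
  "next_state (Plain a) (p, s) = (p + 1, effect a s)"
| "next_state (PosTest a) (p, s) = (if reply a s then p + 1 else p + 2, effect a s)"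
| "next_state (NegTest a) (p, s) = (if reply a s then p + 2 else p + 1, effect a s)"
| "next_state (Jump l) (p, s) = (p + l, s)"
| "next_state Term (p, s) = (p, s)"

lemma exec_unfold:
  "exec X p s s' \<longleftrightarrow> p < length X \<and>
     (if X ! p = Term then s' = s
      else exec X (fst (next_state (X ! p) (p, s))) (snd (next_state (X ! p) (p, s))) s')"
proof (cases "X ! p")
  case (Plain a) then show ?thesis by (subst exec.simps) auto
next
  case (PosTest a) then show ?thesis by (subst exec.simps) auto
next
  case (NegTest a) then show ?thesis by (subst exec.simps) auto
next
  case (Jump l) then show ?thesis by (subst exec.simps) auto
next
  case Term then show ?thesis by (subst exec.simps) auto
qed

lemma exec_length: "exec X p s s' \<Longrightarrow> p < length X"
  using exec_unfold by blast

lemma exec_Term_iff: "X ! p = Term \<Longrightarrow> exec X p s s' \<longleftrightarrow> p < length X \<and> s' = s"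
  by (subst exec_unfold) simp

lemma exec_next_iff:
  "X ! p \<noteq> Term \<Longrightarrow> next_state (X ! p) (p, s) = (p', s'') \<Longrightarrow>
    exec X p s s' \<longleftrightarrow> p < length X \<and> exec X p' s'' s'"
  by (subst exec_unfold) simp

lemma exec_not_Jump_0: "exec X p s s' \<Longrightarrow> X ! p \<noteq> Jump 0"
  by (induction rule: exec.induct) (auto intro!: gr0I)

lemma next_state_increases:
  "u \<noteq> Term \<Longrightarrow> u \<noteq> Jump 0 \<Longrightarrow> next_state u (p, s) = (p', s') \<Longrightarrow> p < p'"
  by (cases u) (auto split: if_splits intro!: gr0I)

lemma exec_next_induct [consumes 1, case_names Term Next]:
  assumes "exec X p s s'"
    and Term: "\<And>p s. p < length X \<Longrightarrow> X ! p = Term \<Longrightarrow> P p s s"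
    and Next: "\<And>p s p' s' s''. p < length X \<Longrightarrow> X ! p \<noteq> Term \<Longrightarrow> p < p' \<Longrightarrow>
      next_state (X ! p) (p, s) = (p', s'') \<Longrightarrow> exec X p' s'' s' \<Longrightarrow> P p' s'' s' \<Longrightarrow> P p s s'"
  shows "P p s s'"
  using assms(1)
proof (induction "length X - p" arbitrary: p s rule: less_induct)
  case less
  show ?case
  proof (cases "X ! p = Term")
    case True
    then show ?thesis using less.prems Term by (simp add: exec_Term_iff)
  next
    case False
    obtain p' s'' where nxt: "next_state (X ! p) (p, s) = (p', s'')" by (metis surj_pair)
    have "p < p'" using next_state_increases[OF False exec_not_Jump_0[OF less.prems] nxt] .
    moreover have "p < length X" and rest: "exec X p' s'' s'"
      using less.prems exec_next_iff[OF False nxt] by simp_all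
    ultimately show ?thesis
      using less.hyps[OF _ rest] by (intro Next[OF _ False _ nxt rest]) simp_all
  qed
qed

lemma exec_deterministic: "exec X p s s' \<Longrightarrow> exec X p s s'' \<Longrightarrow> s' = s''"
proof (induction rule: exec_next_induct)
  case (Term p s)
  then show ?case by (simp add: exec_Term_iff)
next
  case (Next p s p' s' s1)
  then show ?case by (simp add: exec_next_iff[OF Next.hyps(2,4)])
qed

lemma exec_at_last_position:
  assumes "exec X p s s'" "length X = Suc p"
  shows "s' = s"
proof (rule ccontr)
  assume "s' \<noteq> s"
  then have "X ! p \<noteq> Term" using assms(1) by (auto simp: exec_Term_iff)
  obtain p' s1 where nxt: "next_state (X ! p) (p, s) = (p', s1)" by (metis surj_pair)
  have "p < p'"
    using next_state_increases[OF \<open>X ! p \<noteq> Term\<close> exec_not_Jump_0[OF assms(1)] nxt] .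
  moreover have "p' < length X"
    using assms(1) exec_next_iff[OF \<open>X ! p \<noteq> Term\<close> nxt] by (auto dest: exec_length)
  ultimately show False using assms(2) by simp
qed

definition run :: "prim list \<Rightarrow> nat \<Rightarrow> nat \<times> store \<Rightarrow> nat \<times> store" where
  "run X k = ((\<lambda>(p, s). next_state (X ! p) (p, s)) ^^ k)"

lemma run_0 [simp]: "run X 0 c = c"
  by (simp add: run_def)

lemma run_Suc: "run X (Suc k) c = next_state (X ! fst (run X k c)) (run X k c)"
  by (simp add: run_def case_prod_beta)

lemma run_Suc_shift: "run X (Suc k) (p, s) = run X k (next_state (X ! p) (p, s))"
  by (simp only: run_def funpow_Suc_right comp_apply case_prod_conv)

lemma exec_imp_run:
  assumes "exec X p s s'"
  obtains T where "snd (run X T (p, s)) = s'" and "fst (run X T (p, s)) < length X"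
    and "X ! fst (run X T (p, s)) = Term"
    and "\<And>k. k < T \<Longrightarrow> X ! fst (run X k (p, s)) \<noteq> Term \<and>
      fst (run X k (p, s)) < fst (run X (Suc k) (p, s))"
  using assms
proof (induction arbitrary: thesis rule: exec_next_induct)
  case (Term p s)
  then show ?case using Term(3)[of 0] by simp
next
  case (Next p s p' s' s'')
  obtain T where end_run: "snd (run X T (p', s'')) = s'" "fst (run X T (p', s'')) < length X"
      "X ! fst (run X T (p', s'')) = Term"
    and before_end: "\<And>k. k < T \<Longrightarrow> X ! fst (run X k (p', s'')) \<noteq> Term \<and>
      fst (run X k (p', s'')) < fst (run X (Suc k) (p', s''))"
    using Next.IH by blast
  have shift: "run X (Suc k) (p, s) = run X k (p', s'')" for k
    using Next.hyps by (simp add: run_Suc_shift)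
  show ?case
  proof (rule Next.prems[of "Suc T"])
    fix k assume "k < Suc T"
    then show "X ! fst (run X k (p, s)) \<noteq> Term \<and>
        fst (run X k (p, s)) < fst (run X (Suc k) (p, s))"
      using Next.hyps before_end by (cases k) (simp_all add: shift)
  qed (simp_all add: shift end_run)
qed

lemma effect_InReg [simp]: "effect a s (InReg j) = s (InReg j)"
  by (cases a) auto

lemma next_state_InReg: "next_state u (p, s) = (p', s') \<Longrightarrow> s' (InReg j) = s (InReg j)"
  by (cases u) auto

lemma next_state_upd_InReg:
  assumes "u \<noteq> PosTest (InGet i)" "u \<noteq> NegTest (InGet i)" "next_state u (p, s) = (p', s')"
  shows "next_state u (p, s(InReg i := b)) = (p', s'(InReg i := b))"
proof -
  have effect_upd: "effect a (s(InReg i := b)) = (effect a s)(InReg i := b)" for a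
    by (cases a) (auto simp: fun_upd_twist)
  have reply_upd: "a \<noteq> InGet i \<Longrightarrow> reply a (s(InReg i := b)) = reply a s" for a
    by (cases a) auto
  show ?thesis using assms by (cases u) (auto simp: effect_upd reply_upd)
qed

definition yields :: "prim list \<Rightarrow> nat \<Rightarrow> store \<Rightarrow> bool \<Rightarrow> bool" where
  "yields X p s b \<longleftrightarrow> (\<exists>s'. exec X p s s' \<and> s' OutReg = b)"

lemma yields_length: "yields X p s b \<Longrightarrow> p < length X"
  using exec_length unfolding yields_def by blast

lemma yields_exec: "yields X p s b \<Longrightarrow> exec X p s s' \<Longrightarrow> s' OutReg = b"
  using exec_deterministic unfolding yields_def by blast

lemma not_yields_both: "yields X p s True \<Longrightarrow> \<not> yields X p s False"
  using yields_exec unfolding yields_def by metis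

lemma yields_Term_iff: "X ! p = Term \<Longrightarrow> yields X p s b \<longleftrightarrow> p < length X \<and> s OutReg = b"
  unfolding yields_def by (auto simp: exec_Term_iff)

lemma yields_next_iff:
  "X ! p \<noteq> Term \<Longrightarrow> next_state (X ! p) (p, s) = (p', s') \<Longrightarrow>
    yields X p s b \<longleftrightarrow> p < length X \<and> yields X p' s' b"
  unfolding yields_def by (auto simp: exec_next_iff)

section \<open>The test inputs\<close>

definition input_store :: "nat set \<Rightarrow> store" where
  "input_store A r = (case r of InReg j \<Rightarrow> j \<in> A | _ \<Rightarrow> False)"

lemma input_store_simps [simp]:
  "input_store A (InReg j) \<longleftrightarrow> j \<in> A" "\<not> input_store A OutReg" "\<not> input_store A (AuxReg j)"
  by (simp_all add: input_store_def)

lemma input_store_upd [simp]: "(input_store A)(InReg i := True) = input_store (insert i A)"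
  by (auto simp: fun_eq_iff input_store_def split: reg.split)

text \<open>The second argument is the input tested by a directly preceding \<open>+in:d\<close>, and 0 otherwise. In a
  block-structured sequence, the last pair \<open>+in:c; +in:a\<close> starts with the exceptional \<open>e\<close> if that is
  a positive test.\<close>

fun last_test_pair :: "nat \<Rightarrow> nat \<Rightarrow> prim list \<Rightarrow> nat" where
  "last_test_pair c d (PosTest (InGet j) # us) = last_test_pair (if d = 0 then c else d) j us"
| "last_test_pair c d (u # us) = last_test_pair c 0 us"
| "last_test_pair c d [] = c"

definition critical_input :: "prim list \<Rightarrow> nat" where
  "critical_input X = last_test_pair 0 0 X"

text \<open>The index 0 stands for no input.\<close>

definition passes_at :: "prim list \<Rightarrow> nat \<Rightarrow> bool" where
  "passes_at X i \<longleftrightarrow> (\<forall>c \<in> {0, critical_input X}. yields X 0 (input_store ({i, c} - {0})) True)"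

lemma passes_at_unit:
  assumes "passes_at X i" "1 \<le> i"
  shows "yields X 0 (input_store {i}) True"
proof -
  have "yields X 0 (input_store ({i, 0} - {0})) True"
    using assms(1) unfolding passes_at_def by blast
  moreover have "{i, 0} - {0} = {i}" using assms(2) by auto
  ultimately show ?thesis by simp
qed

definition passes :: "prim list \<Rightarrow> nat \<Rightarrow> bool" where
  "passes X n \<longleftrightarrow> yields X 0 (input_store {}) False \<and> (\<forall>i \<in> {1..n}. passes_at X i)"

section \<open>The block structure forced by minimal length\<close>

text \<open>In terms of blocks: \<open>-in:a; +in:b; e\<close> (two inputs) or \<open>+in:a; e\<close> (one input), followed by
  a final \<open>!\<close>. \<open>test i\<close> is the position of the decisive test of \<open>in:i\<close>, and \<open>exits\<close> is the set of
  positions of the instructions \<open>e\<close>. By \<open>skip_unique\<close> at most one \<open>e\<close> is directly followed by a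
  one-input block; only this \<open>e\<close> can skip into another \<open>e\<close>.\<close>

locale block_structure =
  fixes X :: "prim list" and n :: nat
    and test :: "nat \<Rightarrow> nat" and exits :: "nat set" and final :: nat
  assumes cover: "{..<length X} = test ` {1..n} \<union> exits \<union> {final}"
    and tests_disjoint_exits: "test ` {1..n} \<inter> exits = {}"
    and final_notin_exits: "final \<notin> exits"
    and final_notin_tests: "final \<notin> test ` {1..n}"
    and length_eq: "length X = Suc final"
    and Term_final: "X ! final = Term"
    and inj_test: "inj_on test {1..n}"
    and test_successors: "i \<in> {1..n} \<Longrightarrow>
        X ! test i = PosTest (InGet i) \<and> test i + 1 \<in> exits \<and> test i + 2 \<in> test ` {1..n} \<union> {final} \<or>
        X ! test i = NegTest (InGet i) \<and> test i + 1 \<in> test ` {1..n} \<and> test i + 2 \<in> exits"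
    and exit_pred: "q \<in> exits \<Longrightarrow> \<exists>i \<in> {1..n}. q = test i + 1 \<and> X ! test i = PosTest (InGet i)"
    and skip_unique: "\<lbrakk>q \<in> exits; q + 2 \<in> exits; q' \<in> exits; q' + 2 \<in> exits\<rbrakk> \<Longrightarrow> q = q'"
    and exit_succ: "q \<in> exits \<Longrightarrow> q + 1 \<in> test ` {1..n} \<union> {final}"
    and start: "0 \<in> test ` {1..n} \<union> {final}"

locale correct_on_units =
  fixes X :: "prim list" and n :: nat
  assumes length_L: "length X = L n"
    and zero: "yields X 0 (input_store {}) False"
    and unit: "i \<in> {1..n} \<Longrightarrow> yields X 0 (input_store {i}) True"
begin

subsection \<open>The run on the zero vector\<close>

definition pos :: "nat \<Rightarrow> nat" where "pos k = fst (run X k (0, input_store {}))"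

definition sto :: "nat \<Rightarrow> store" where "sto k = snd (run X k (0, input_store {}))"

definition halt :: nat where "halt = (LEAST k. X ! pos k = Term)"

definition visited :: "nat set" where "visited = pos ` {..halt}"

abbreviation "final \<equiv> pos halt"

lemma pos_0 [simp]: "pos 0 = 0" and sto_0 [simp]: "sto 0 = input_store {}"
  by (simp_all add: pos_def sto_def)

lemma next_state_pos: "next_state (X ! pos k) (pos k, sto k) = (pos (Suc k), sto (Suc k))"
  by (simp add: pos_def sto_def run_Suc)

lemma final_less_length: "final < length X"
  and Term_final: "X ! final = Term"
  and output_at_halt: "\<not> sto halt OutReg"
  and not_Term_before_halt: "k < halt \<Longrightarrow> X ! pos k \<noteq> Term"
  and pos_less_Suc: "k < halt \<Longrightarrow> pos k < pos (Suc k)"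
proof -
  obtain s' where "exec X 0 (input_store {}) s'" "\<not> s' OutReg"
    using zero by (auto simp: yields_def)
  then obtain T where end_run: "\<not> sto T OutReg" "pos T < length X" "X ! pos T = Term"
    and before: "\<And>k. k < T \<Longrightarrow> X ! pos k \<noteq> Term \<and> pos k < pos (Suc k)"
    by (elim exec_imp_run) (auto simp: pos_def sto_def)
  have "halt = T" unfolding halt_def
  proof (rule Least_equality)
    show "T \<le> k" if "X ! pos k = Term" for k using before[of k] that by (meson not_le)
  qed (fact end_run(3))
  then show "final < length X" "X ! final = Term" "\<not> sto halt OutReg"
    and "k < halt \<Longrightarrow> X ! pos k \<noteq> Term" "k < halt \<Longrightarrow> pos k < pos (Suc k)"
    using end_run before by auto
qed

lemma pos_strict_mono: "k < l \<Longrightarrow> l \<le> halt \<Longrightarrow> pos k < pos l"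
proof (induction l)
  case (Suc l)
  then show ?case using pos_less_Suc[of l] by (cases "k = l") auto
qed simp

lemma pos_mono: "k \<le> l \<Longrightarrow> l \<le> halt \<Longrightarrow> pos k \<le> pos l"
  using pos_strict_mono[of k l] by (cases "k = l") auto

lemma pos_eqD: "pos k = pos l \<Longrightarrow> k \<le> halt \<Longrightarrow> l \<le> halt \<Longrightarrow> k = l"
  using pos_strict_mono[of k l] pos_strict_mono[of l k] by (cases k l rule: linorder_cases) auto

lemma pos_Suc_le: "k < halt \<Longrightarrow> l \<le> halt \<Longrightarrow> pos k < pos l \<Longrightarrow> pos (Suc k) \<le> pos l"
  using pos_mono[of l k] pos_mono[of "Suc k" l] by (cases "k < l") auto

lemma sto_InReg: "\<not> sto k (InReg j)"
proof (induction k)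
  case (Suc k) then show ?case using next_state_InReg[OF next_state_pos] by simp
qed simp

lemma visited_le_final: "p \<in> visited \<Longrightarrow> p \<le> final"
  using pos_mono by (auto simp: visited_def)

lemma final_visited: "final \<in> visited"
  by (auto simp: visited_def)

subsection \<open>Decisive tests\<close>

text \<open>The decisive test of \<open>in:i\<close> is at the last position of this run at which flipping \<open>in:i\<close> still
  leads to output 1.\<close>

definition flips :: "nat \<Rightarrow> nat \<Rightarrow> bool" where
  "flips i k \<longleftrightarrow> yields X (pos k) ((sto k)(InReg i := True)) True"

definition last_flip :: "nat \<Rightarrow> nat" where "last_flip i = Max {k. k \<le> halt \<and> flips i k}"

definition test :: "nat \<Rightarrow> nat" where "test i = pos (last_flip i)"

abbreviation "tests \<equiv> test ` {1..n}"

lemma not_flips_halt: "\<not> flips i halt"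
  using Term_final output_at_halt by (simp add: flips_def yields_Term_iff)

lemma
  assumes "i \<in> {1..n}"
  shows last_flip_less_halt: "last_flip i < halt"
    and flips_last_flip: "flips i (last_flip i)"
    and not_flips_later: "\<And>k. last_flip i < k \<Longrightarrow> k \<le> halt \<Longrightarrow> \<not> flips i k"
proof -
  have "flips i 0" using unit[OF assms] by (simp add: flips_def)
  moreover have finite: "finite {k. k \<le> halt \<and> flips i k}" by simp
  ultimately have "last_flip i \<in> {k. k \<le> halt \<and> flips i k}"
    unfolding last_flip_def by (intro Max_in) auto
  then show "flips i (last_flip i)" and "last_flip i < halt"
    using not_flips_halt[of i] by (simp_all add: less_le) metis
  show "\<not> flips i k" if "last_flip i < k" "k \<le> halt" for k
    using Max_ge[OF finite, of k] that by (auto simp flip: last_flip_def)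
qed

lemma test_reads:
  assumes "i \<in> {1..n}"
  shows "X ! test i = PosTest (InGet i) \<or> X ! test i = NegTest (InGet i)"
proof (rule ccontr)
  assume "\<not> ?thesis"
  then have "next_state (X ! test i) (test i, (sto (last_flip i))(InReg i := True))
      = (pos (Suc (last_flip i)), (sto (Suc (last_flip i)))(InReg i := True))"
    using next_state_upd_InReg[OF _ _ next_state_pos] by (simp add: test_def)
  then have "flips i (Suc (last_flip i))"
    using flips_last_flip[OF assms]
      yields_next_iff[OF not_Term_before_halt[OF last_flip_less_halt[OF assms]]]
    unfolding flips_def test_def by simp
  then show False
    using last_flip_less_halt[OF assms] not_flips_later[OF assms, of "Suc (last_flip i)"] by simp
qed

lemma inj_test: "inj_on test {1..n}"
proof (rule inj_on_inverseI)
  fix i assume "i \<in> {1..n}"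
  from test_reads[OF this]
  show "(case X ! test i of PosTest (InGet i) \<Rightarrow> i | NegTest (InGet i) \<Rightarrow> i) = i"
    by (elim disjE) simp_all
qed

lemma sto_after_test:
  assumes "pos k \<in> tests"
  shows "sto (Suc k) = sto k"
proof -
  obtain i where "i \<in> {1..n}" "pos k = test i" using assms by auto
  then show ?thesis using test_reads[of i] next_state_pos[of k] by (auto split: if_splits)
qed

lemma pos_last_flip: "i \<in> {1..n} \<Longrightarrow> pos (last_flip i) \<in> tests"
  by (simp flip: test_def)

lemma
  assumes i: "i \<in> {1..n}" and X: "X ! test i = PosTest (InGet i)"
  shows pos_after_PosTest: "pos (Suc (last_flip i)) = test i + 2"
    and Suc_PosTest_not_visited: "test i + 1 \<notin> visited"
    and yields_Suc_PosTest: "yields X (test i + 1) ((sto (last_flip i))(InReg i := True)) True"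
proof -
  show succ: "pos (Suc (last_flip i)) = test i + 2"
    using next_state_pos[of "last_flip i"] X sto_InReg by (auto simp: test_def)
  show "test i + 1 \<notin> visited"
    using pos_Suc_le[OF last_flip_less_halt[OF i]] succ unfolding visited_def
    by (force simp: test_def)
  show "yields X (test i + 1) ((sto (last_flip i))(InReg i := True)) True"
    using flips_last_flip[OF i] X unfolding flips_def test_def[symmetric]
    by (subst (asm) yields_next_iff) auto
qed

lemma
  assumes i: "i \<in> {1..n}" and X: "X ! test i = NegTest (InGet i)"
  shows pos_after_NegTest: "pos (Suc (last_flip i)) = test i + 1"
    and yields_skip_NegTest: "yields X (test i + 2) ((sto (last_flip i))(InReg i := True)) True"
proof -
  show "pos (Suc (last_flip i)) = test i + 1"
    using next_state_pos[of "last_flip i"] X sto_InReg by (auto simp: test_def)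
  show "yields X (test i + 2) ((sto (last_flip i))(InReg i := True)) True"
    using flips_last_flip[OF i] X unfolding flips_def test_def[symmetric]
    by (subst (asm) yields_next_iff) auto
qed

lemma tests_visited: "tests \<subseteq> visited"
  using last_flip_less_halt by (fastforce simp: test_def visited_def)

lemma final_notin_tests: "final \<notin> tests"
  using test_reads Term_final by force

lemma tests_less_final: "p \<in> tests \<Longrightarrow> p < final"
  using tests_visited visited_le_final final_notin_tests by (metis in_mono le_neq_implies_less)

subsection \<open>Counting\<close>

text \<open>Each closing test owns the instruction right after it, and the leading tests inject into the
  closing tests by \<open>Suc\<close>. So there are at least \<open>n/2\<close> owned instructions besides the \<open>n\<close> decisive
  tests and the final \<open>!\<close>, which leaves no slack in length \<open>L n\<close>.\<close>

definition leading :: "nat set" where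
  "leading = {test i | i. i \<in> {1..n} \<and> X ! test i = NegTest (InGet i) \<and> test i + 1 \<in> tests}"

definition closing :: "nat set" where "closing = tests - leading"

definition exits :: "nat set" where "exits = Suc ` closing"

lemma exitsE:
  assumes "q \<in> exits"
  obtains i where "i \<in> {1..n}" "test i \<in> closing" "q = Suc (test i)"
  using assms by (auto simp: exits_def closing_def)

lemma leading_subset: "leading \<subseteq> tests"
  by (auto simp: leading_def)

text \<open>Two negative tests in a row would lead to the same position after either reply of the first
  test, which would then not be decisive.\<close>

lemma Suc_leading:
  assumes "p \<in> leading"
  obtains j where "j \<in> {1..n}" "Suc p = test j" "X ! test j = PosTest (InGet j)"
proof -
  obtain i j where i: "i \<in> {1..n}" "p = test i" "X ! test i = NegTest (InGet i)"
    and j: "j \<in> {1..n}" "test i + 1 = test j"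
    using assms by (auto simp: leading_def)
  have "X ! test j \<noteq> NegTest (InGet j)"
  proof
    assume neg: "X ! test j = NegTest (InGet j)"
    have "pos (last_flip j) = pos (Suc (last_flip i))"
      using pos_after_NegTest[OF i(1,3)] j(2) by (simp add: test_def)
    then have later: "last_flip j = Suc (last_flip i)"
      by (rule pos_eqD) (use last_flip_less_halt[OF i(1)] last_flip_less_halt[OF j(1)] in simp_all)
    have "pos (Suc (last_flip j)) = test i + 2"
      using pos_after_NegTest[OF j(1) neg] j(2) by simp
    moreover have "sto (Suc (last_flip j)) = sto (last_flip i)"
      using sto_after_test[OF pos_last_flip[OF i(1)]] sto_after_test[OF pos_last_flip[OF j(1)]]
        later by simp
    ultimately have "flips i (Suc (last_flip j))"
      using yields_skip_NegTest[OF i(1,3)] by (simp add: flips_def)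
    then show False
      using not_flips_later[OF i(1), of "Suc (last_flip j)"] later last_flip_less_halt[OF j(1)]
      by simp
  qed
  then show thesis using that[OF j(1)] test_reads[OF j(1)] i(2) j(2) by simp
qed

lemma PosTest_notin_leading: "X ! p = PosTest a \<Longrightarrow> p \<notin> leading"
  by (auto simp: leading_def)

lemma Suc_leading_subset: "Suc ` leading \<subseteq> closing"
proof
  fix q assume "q \<in> Suc ` leading"
  then obtain p where p: "p \<in> leading" "q = Suc p" by blast
  from p(1) obtain j where "j \<in> {1..n}" "Suc p = test j" "X ! test j = PosTest (InGet j)"
    by (rule Suc_leading)
  then show "q \<in> closing" using p(2) PosTest_notin_leading by (auto simp: closing_def)
qed

lemma tests_disjoint_exits: "tests \<inter> exits = {}"
proof -
  have "Suc (test i) \<notin> tests" if i: "i \<in> {1..n}" "test i \<in> closing" for i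
    using test_reads[OF i(1)]
  proof
    assume "X ! test i = PosTest (InGet i)"
    then show ?thesis using Suc_PosTest_not_visited[OF i(1)] tests_visited by auto
  next
    assume "X ! test i = NegTest (InGet i)"
    then show ?thesis using i by (auto simp: closing_def leading_def)
  qed
  then show ?thesis by (metis disjoint_iff exitsE)
qed

lemma Suc_exit_notin_exits:
  assumes "q \<in> exits"
  shows "Suc q \<notin> exits"
proof
  assume "Suc q \<in> exits"
  then obtain i where "i \<in> {1..n}" "Suc q = Suc (test i)" by (rule exitsE)
  then show False using assms tests_disjoint_exits by blast
qed

lemma exits_less_length: "q \<in> exits \<Longrightarrow> q < length X"
proof (elim exitsE)
  fix i assume i: "i \<in> {1..n}" and q: "q = Suc (test i)"
  from test_reads[OF i] show "q < length X"
  proof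
    assume "X ! test i = PosTest (InGet i)"
    then show ?thesis using yields_length[OF yields_Suc_PosTest[OF i]] q by simp
  next
    assume "X ! test i = NegTest (InGet i)"
    then show ?thesis
      using pos_after_NegTest[OF i] pos_mono[of "Suc (last_flip i)" halt] last_flip_less_halt[OF i]
        final_less_length q by simp
  qed
qed

lemma tests_less_length: "p \<in> tests \<Longrightarrow> p < length X"
  using tests_less_final final_less_length by fastforce

lemma finite_leading: "finite leading" and finite_closing: "finite closing"
  using finite_subset[OF leading_subset] by (simp_all add: closing_def)

lemma card_leading_le: "card leading \<le> card closing"
  using card_mono[OF finite_closing Suc_leading_subset] by (simp add: card_image)

lemma card_closing_leading: "card closing + card leading = n"
proof -
  have "card tests = n" using card_image[OF inj_test] by simp
  moreover have "card leading \<le> card tests" using leading_subset by (simp add: card_mono)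
  ultimately show ?thesis
    using card_Diff_subset[OF finite_leading leading_subset] by (simp add: closing_def)
qed

lemma
  assumes "x \<notin> tests" "x \<notin> exits" "x < length X"
  shows positions_eq: "{..<length X} = tests \<union> exits \<union> {x}"
    and card_unpaired_le: "card (closing - Suc ` leading) \<le> 1"
proof -
  have "finite exits" "card exits = card closing"
    using finite_closing by (simp_all add: exits_def card_image)
  then have "card (tests \<union> exits) = n + card closing"
    using card_Un_disjoint[OF _ _ tests_disjoint_exits] card_image[OF inj_test] by simp
  then have card_used: "card (tests \<union> exits \<union> {x}) = n + card closing + 1"
    using assms(1,2) \<open>finite exits\<close> by simp
  have used: "tests \<union> exits \<union> {x} \<subseteq> {..<length X}"
    using assms(3) tests_less_length exits_less_length by auto
  then have "n + card closing + 1 \<le> L n"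
    using card_mono[OF _ used] card_used length_L by simp
  then have closing: "card closing = (n + 1) div 2"
    using card_leading_le card_closing_leading unfolding L_eq by linarith
  show "{..<length X} = tests \<union> exits \<union> {x}"
    by (rule card_subset_eq[symmetric]) (use used card_used closing length_L in \<open>auto simp: L_eq\<close>)
  have "card (closing - Suc ` leading) = card closing - card leading"
    using card_Diff_subset[OF _ Suc_leading_subset] finite_leading by (simp add: card_image)
  then show "card (closing - Suc ` leading) \<le> 1"
    using closing card_leading_le card_closing_leading by linarith
qed

lemma final_notin_exits: "final \<notin> exits"
proof
  assume "final \<in> exits"
  then obtain i where i: "i \<in> {1..n}" "final = Suc (test i)" by (rule exitsE)
  have neg: "X ! test i = NegTest (InGet i)"
    using test_reads[OF i(1)] Suc_PosTest_not_visited[OF i(1)] final_visited i(2) by auto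
  let ?s = "(sto (last_flip i))(InReg i := True)"
  have yields: "yields X (final + 1) ?s True" using yields_skip_NegTest[OF i(1) neg] i(2) by simp
  have "final + 1 \<notin> tests" using tests_less_final by fastforce
  moreover have "final + 1 \<notin> exits" using final_notin_tests by (auto elim: exitsE)
  ultimately have cover: "{..<length X} = tests \<union> exits \<union> {final + 1}"
    using positions_eq yields_length[OF yields] by blast
  have "final + 2 \<notin> tests \<union> exits \<union> {final + 1}"
    using tests_less_final by (fastforce elim: exitsE)
  then have "\<not> final + 2 < length X" using cover by blast
  then have "length X = Suc (final + 1)" using yields_length[OF yields] by simp
  then have "sto (last_flip i) OutReg"
    using yields exec_at_last_position unfolding yields_def by fastforce
  moreover have "Suc (last_flip i) = halt"
    by (rule pos_eqD) (use pos_after_NegTest[OF i(1) neg] i(2) last_flip_less_halt[OF i(1)] in auto)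
  moreover have "sto (Suc (last_flip i)) = sto (last_flip i)"
    using i(1) by (intro sto_after_test pos_last_flip)
  ultimately show False using output_at_halt by simp
qed

lemma cover: "{..<length X} = tests \<union> exits \<union> {final}"
  using positions_eq final_notin_exits final_notin_tests final_less_length by blast

lemma position_cases: "p < length X \<Longrightarrow> p \<in> tests \<or> p \<in> exits \<or> p = final"
  using cover by (metis Un_iff lessThan_iff singletonD)

lemma unpaired_unique: "p \<in> closing - Suc ` leading \<Longrightarrow> q \<in> closing - Suc ` leading \<Longrightarrow> p = q"
  using card_unpaired_le[OF final_notin_tests final_notin_exits final_less_length] finite_closing
  by (auto simp: card_le_Suc0_iff_eq)

subsection \<open>Closing tests are positive\<close>

lemma exec_only_tests:
  assumes "\<And>l. k \<le> l \<Longrightarrow> l < halt \<Longrightarrow> pos l \<in> tests" "k \<le> halt"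
    and "\<And>j. j \<in> {1..n} \<Longrightarrow> pos k \<le> test j \<Longrightarrow> \<not> s (InReg j)"
  shows "exec X (pos k) s s"
  using assms(2,1,3)
proof (induction k rule: inc_induct)
  case base
  then show ?case using final_less_length Term_final by (simp add: exec_Term_iff)
next
  case (step l)
  obtain j where j: "j \<in> {1..n}" "pos l = test j" using step.prems(1)[of l] step.hyps by auto
  have "\<not> s (InReg j)" using step.prems(2)[OF j(1)] j(2) by simp
  then have "next_state (X ! pos l) (pos l, s) = (pos (Suc l), s)"
    using next_state_pos[of l] test_reads[OF j(1)] sto_InReg[of l j] j by auto
  moreover have "exec X (pos (Suc l)) s s"
    by (rule step.IH) (use step pos_less_Suc[of l] in auto)
  moreover have "pos l < length X" using j tests_less_length by simp
  ultimately show ?case using not_Term_before_halt[OF step.hyps(2)] exec_next_iff by simp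
qed

lemma sto_only_tests: "(\<And>l. l < k \<Longrightarrow> pos l \<in> tests) \<Longrightarrow> sto k = input_store {}"
  by (induction k) (simp_all add: sto_after_test)

lemma paired_not_NegTest: "q \<in> Suc ` leading \<Longrightarrow> X ! q \<noteq> NegTest a"
  by (auto elim!: Suc_leading)

lemma pos_in_tests_or_unpaired_exit:
  assumes "l < halt"
  shows "pos l \<in> tests \<union> Suc ` (closing - Suc ` leading)"
proof (rule ccontr)
  assume outside: "pos l \<notin> tests \<union> Suc ` (closing - Suc ` leading)"
  have "pos l < length X" "pos l \<noteq> final"
    using pos_strict_mono[of l halt] assms final_less_length by auto
  then have "pos l \<in> exits" using position_cases outside by blast
  then obtain j where j: "j \<in> {1..n}" "test j \<in> closing" "pos l = Suc (test j)" by (rule exitsE)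
  then have "test j \<in> Suc ` leading" using outside by blast
  then have "X ! test j = PosTest (InGet j)" using paired_not_NegTest test_reads[OF j(1)] by blast
  then have "pos l \<notin> visited" using Suc_PosTest_not_visited[OF j(1)] j(3) by simp
  then show False using assms by (auto simp: visited_def)
qed

lemma pos_Suc_eq:
  assumes "k < halt" "Suc (pos k) \<notin> exits"
  shows "pos (Suc k) = Suc (pos k)"
proof -
  have "Suc (pos k) \<le> final"
    using pos_less_Suc[OF assms(1)] pos_mono[of "Suc k" halt] assms(1) by simp
  then have "Suc (pos k) \<in> visited"
    using position_cases[of "Suc (pos k)"] assms(2) final_less_length tests_visited final_visited
    by (metis in_mono le_less_trans)
  then obtain l where "l \<le> halt" "pos l = Suc (pos k)" by (auto simp: visited_def)
  then show ?thesis using pos_Suc_le[OF assms(1), of l] pos_less_Suc[OF assms(1)] by simp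
qed

text \<open>If a closing test were negative, the run would visit its exit and otherwise only tests. With
  the input of this test flipped, the run would skip this exit and thus never set the output.\<close>

lemma closing_PosTest:
  assumes i: "i \<in> {1..n}" "test i \<in> closing"
  shows "X ! test i = PosTest (InGet i)"
proof (rule ccontr)
  assume "\<not> ?thesis"
  then have neg: "X ! test i = NegTest (InGet i)" using test_reads[OF i(1)] by blast
  let ?k = "Suc (last_flip i)" and ?s = "(sto (last_flip i))(InReg i := True)"
  have exit: "Suc (test i) \<in> exits" using i(2) by (simp add: exits_def)
  have pos_k: "pos ?k = Suc (test i)" using pos_after_NegTest[OF i(1) neg] by simp
  then have "?k \<noteq> halt" using exit final_notin_exits by metis
  then have k_less: "?k < halt" using last_flip_less_halt[OF i(1)] by simp
  have pos_Suc_k: "pos (Suc ?k) = test i + 2"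
    using pos_Suc_eq[OF k_less] pos_k Suc_exit_notin_exits[OF exit] by simp
  have "test i \<in> closing - Suc ` leading" using i(2) neg paired_not_NegTest by blast
  then have only_tests: "pos l \<in> tests" if "l < halt" "pos l \<noteq> Suc (test i)" for l
    using pos_in_tests_or_unpaired_exit[OF that(1)] that(2) unpaired_unique by blast
  have "exec X (pos (Suc ?k)) ?s ?s"
  proof (rule exec_only_tests)
    show "pos l \<in> tests" if "Suc ?k \<le> l" "l < halt" for l
      using only_tests that pos_mono[of "Suc ?k" l] pos_Suc_k by simp
    show "\<not> ?s (InReg j)" if "pos (Suc ?k) \<le> test j" for j
      using that pos_Suc_k sto_InReg by auto
  qed (use k_less in simp)
  then have "sto (last_flip i) OutReg"
    using yields_exec[OF yields_skip_NegTest[OF i(1) neg]] unfolding pos_Suc_k by fastforce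
  moreover have "sto (last_flip i) = input_store {}"
  proof (rule sto_only_tests)
    fix l assume "l < last_flip i"
    then show "pos l \<in> tests"
      using only_tests[of l] pos_strict_mono[of l "last_flip i"] last_flip_less_halt[OF i(1)]
      by (simp add: test_def)
  qed
  ultimately show False by simp
qed

lemma exits_not_visited: "q \<in> exits \<Longrightarrow> q \<notin> visited"
  using Suc_PosTest_not_visited closing_PosTest by (auto elim!: exitsE)

lemma visited_eq: "visited = tests \<union> {final}"
proof
  show "visited \<subseteq> tests \<union> {final}"
  proof
    fix p assume "p \<in> visited"
    then have "p < length X" "p \<notin> exits"
      using visited_le_final final_less_length exits_not_visited by fastforce+
    then show "p \<in> tests \<union> {final}" using position_cases by blast
  qed
qed (use tests_visited final_visited in blast)

lemma test_successors:
  assumes i: "i \<in> {1..n}"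
  shows "X ! test i = PosTest (InGet i) \<and> test i + 1 \<in> exits \<and> test i + 2 \<in> tests \<union> {final} \<or>
    X ! test i = NegTest (InGet i) \<and> test i + 1 \<in> tests \<and> test i + 2 \<in> exits"
  using test_reads[OF i]
proof
  assume pos: "X ! test i = PosTest (InGet i)"
  have "test i \<in> closing" using i PosTest_notin_leading[OF pos] by (simp add: closing_def)
  then have "test i + 1 \<in> exits" by (simp add: exits_def)
  moreover have "pos (Suc (last_flip i)) \<in> visited"
    using last_flip_less_halt[OF i] by (simp add: visited_def)
  then have "test i + 2 \<in> tests \<union> {final}"
    using pos_after_PosTest[OF i pos] visited_eq by simp
  ultimately show ?thesis using pos by blast
next
  assume neg: "X ! test i = NegTest (InGet i)"
  then have "test i \<in> leading" using closing_PosTest[OF i] i by (auto simp: closing_def)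
  then have "Suc (test i) \<in> closing" using Suc_leading_subset by blast
  then have "test i + 1 \<in> tests" "test i + 2 \<in> exits" by (simp_all add: closing_def exits_def)
  then show ?thesis using neg by blast
qed

lemma length_eq_Suc_final: "length X = Suc final"
proof (rule ccontr)
  assume "length X \<noteq> Suc final"
  then have "Suc final \<in> tests \<or> Suc final \<in> exits"
    using position_cases[of "Suc final"] final_less_length by simp
  then show False using tests_less_final final_notin_tests by (fastforce elim!: exitsE)
qed

lemma skip_unique:
  assumes "q \<in> exits" "q + 2 \<in> exits" "q' \<in> exits" "q' + 2 \<in> exits"
  shows "q = q'"
proof -
  have "q + 1 \<in> closing - Suc ` leading" if "q \<in> exits" "q + 2 \<in> exits" for q
  proof -
    have "q + 1 \<in> closing" using that(2) by (auto simp: exits_def)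
    moreover have "q \<notin> leading" using that(1) leading_subset tests_disjoint_exits by blast
    ultimately show ?thesis by auto
  qed
  then show ?thesis using assms unpaired_unique[of "q + 1" "q' + 1"] by simp
qed

lemma exit_succ:
  assumes "q \<in> exits"
  shows "q + 1 \<in> tests \<union> {final}"
proof -
  have "q \<noteq> final" "q < length X" using assms final_notin_exits exits_less_length by auto
  then have "q + 1 < length X" using length_eq_Suc_final by simp
  then show ?thesis using position_cases Suc_exit_notin_exits[OF assms] by auto
qed

lemma block_structure: "block_structure X n test exits final"
proof
  show "\<exists>i\<in>{1..n}. q = test i + 1 \<and> X ! test i = PosTest (InGet i)" if "q \<in> exits" for q
    using that by (auto elim!: exitsE intro: closing_PosTest)
  show "0 \<in> tests \<union> {final}"
    using visited_eq by (force simp: visited_def)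
qed (use cover tests_disjoint_exits final_notin_exits final_notin_tests length_eq_Suc_final
    Term_final inj_test test_successors skip_unique exit_succ in auto)

end

section \<open>The critical input\<close>

lemma last_test_pair_unchanged:
  assumes "\<And>p i j. Suc p < length us \<Longrightarrow> us ! p = PosTest (InGet i) \<Longrightarrow> us ! Suc p \<noteq> PosTest (InGet j)"
    and "d = 0 \<or> (\<forall>j vs. us \<noteq> PosTest (InGet j) # vs)"
  shows "last_test_pair c d us = c"
  using assms
proof (induction c d us rule: last_test_pair.induct)
  case (1 c d j us)
  have "d = 0" using "1.prems"(2) by blast
  moreover have "last_test_pair (if d = 0 then c else d) j us = (if d = 0 then c else d)"
    using "1.prems"(1)[of "Suc p" for p] "1.prems"(1)[of 0 j] by (intro "1.IH") fastforce+
  ultimately show ?case by simp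
qed (fastforce intro: Suc_less_eq[THEN iffD2])+

lemma last_test_pair_eq:
  assumes "Suc q < length us" "us ! q = PosTest (InGet i)" "us ! Suc q = PosTest (InGet j)" "i \<noteq> 0"
    and last: "\<And>p i j. q < p \<Longrightarrow> Suc p < length us \<Longrightarrow> us ! p = PosTest (InGet i) \<Longrightarrow>
      us ! Suc p \<noteq> PosTest (InGet j)"
  shows "last_test_pair c d us = i"
  using assms
proof (induction us arbitrary: q c d)
  case (Cons u us)
  show ?case
  proof (cases q)
    case (Suc q')
    have "last_test_pair c' d' us = i" for c' d'
      by (rule Cons.IH[of q']) (use Cons.prems(1-4) Cons.prems(5)[of "Suc p" for p] Suc in auto)
    then show ?thesis by (cases "(c, d, u # us)" rule: last_test_pair.cases) auto
  next
    case 0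
    then obtain vs where vs: "u # us = PosTest (InGet i) # PosTest (InGet j) # vs"
      using Cons.prems by (cases us) auto
    have "last_test_pair i j vs = i"
    proof (rule last_test_pair_unchanged)
      show "vs ! Suc p \<noteq> PosTest (InGet j')"
        if "Suc p < length vs" "vs ! p = PosTest (InGet i')" for p i' j'
        using Cons.prems(5)[of "Suc (Suc p)" i' j'] that 0 vs by simp
      show "j = 0 \<or> (\<forall>j' vs'. vs \<noteq> PosTest (InGet j') # vs')"
        using Cons.prems(5)[of 1 j] 0 vs by fastforce
    qed
    then show ?thesis using Cons.prems(4) vs by simp
  qed
qed simp

section \<open>Correctness of sequences that pass the tests\<close>

context block_structure
begin

abbreviation "tests \<equiv> test ` {1..n}"

lemma position_cases: "p < length X \<Longrightarrow> p \<in> tests \<or> p \<in> exits \<or> p = final"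
  using cover by (metis Un_iff lessThan_iff singletonD)

lemma test_less_length: "p \<in> tests \<union> {final} \<Longrightarrow> p < length X"
  and exit_less_length: "p \<in> exits \<Longrightarrow> p < length X"
  using cover by (metis Un_iff lessThan_iff)+

lemma test_reads: "p \<in> tests \<Longrightarrow> \<exists>i. X ! p = PosTest (InGet i) \<or> X ! p = NegTest (InGet i)"
  using test_successors by blast

subsection \<open>Runs through the decisive tests\<close>

definition entry :: "nat \<Rightarrow> nat" where
  "entry i = (if X ! test i = PosTest (InGet i) then test i + 1 else test i + 2)"

definition following :: "nat \<Rightarrow> nat" where
  "following i = (if X ! test i = PosTest (InGet i) then test i + 2 else test i + 1)"

lemma entry_exit: "i \<in> {1..n} \<Longrightarrow> entry i \<in> exits"
  using test_successors[of i] by (auto simp: entry_def)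

lemma test_less_entry: "test i < entry i"
  by (simp add: entry_def)

lemma following_test: "i \<in> {1..n} \<Longrightarrow> following i \<in> tests \<union> {final}"
  using test_successors[of i] by (auto simp: following_def)

lemma test_less_following: "test i < following i"
  by (simp add: following_def)

lemma following_le:
  assumes "i \<in> {1..n}" "p \<in> tests" "test i < p"
  shows "following i \<le> p"
proof -
  have "p \<noteq> test i + 1" if "X ! test i = PosTest (InGet i)"
    using test_successors[OF assms(1)] tests_disjoint_exits assms(2) that by auto
  then show ?thesis using assms(3) by (auto simp: following_def)
qed

lemma exec_test:
  assumes "i \<in> {1..n}"
  shows "exec X (test i) s s' \<longleftrightarrow> exec X (if s (InReg i) then entry i else following i) s s'"
proof -
  have "next_state (X ! test i) (test i, s) = (if s (InReg i) then entry i else following i, s)"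
    and "X ! test i \<noteq> Term"
    using test_successors[OF assms] by (auto simp: entry_def following_def)
  then show ?thesis using test_less_length[of "test i"] assms by (simp add: exec_next_iff)
qed

lemma exec_zero_inputs:
  assumes "p \<in> tests \<union> {final}" "\<And>j. j \<in> {1..n} \<Longrightarrow> p \<le> test j \<Longrightarrow> \<not> s (InReg j)"
  shows "exec X p s s"
  using assms
proof (induction "length X - p" arbitrary: p rule: less_induct)
  case less
  show ?case
  proof (cases "p = final")
    case True
    then show ?thesis using length_eq Term_final by (simp add: exec_Term_iff)
  next
    case False
    then obtain i where i: "i \<in> {1..n}" "p = test i" using less.prems(1) by blast
    have "exec X (following i) s s"
      using following_test[OF i(1)] test_less_following[of i] test_less_length[OF less.prems(1)] i
      by (intro less.hyps less.prems(2)) auto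
    moreover have "\<not> s (InReg i)" using less.prems(2) i by simp
    ultimately show ?thesis unfolding i(2) exec_test[OF i(1)] by simp
  qed
qed

lemma exec_first_nonzero_input:
  assumes i: "i \<in> {1..n}" "s (InReg i)"
    and "p \<in> tests \<union> {final}" "p \<le> test i"
    and "\<And>j. j \<in> {1..n} \<Longrightarrow> p \<le> test j \<Longrightarrow> test j < test i \<Longrightarrow> \<not> s (InReg j)"
  shows "exec X p s s' \<longleftrightarrow> exec X (entry i) s s'"
  using assms(3-)
proof (induction "length X - p" arbitrary: p rule: less_induct)
  case less
  have p_less: "p < length X" using test_less_length less.prems(1) by blast
  have "test i < final"
    using test_less_length[of "test i"] final_notin_tests i(1) length_eq
    by (metis Un_iff imageI less_SucE)
  then obtain j where j: "j \<in> {1..n}" "p = test j" using less.prems(1,2) by auto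
  show ?case
  proof (cases "j = i")
    case True
    then show ?thesis using exec_test[OF i(1)] i(2) j(2) by simp
  next
    case False
    then have "test j < test i"
      using less.prems(2) inj_test i(1) j by (metis inj_onD le_neq_implies_less)
    then have "\<not> s (InReg j)" "following j \<le> test i"
      using less.prems(3)[OF j(1)] j following_le i(1) by simp_all
    moreover have "exec X (following j) s s' \<longleftrightarrow> exec X (entry i) s s'"
      using following_test[OF j(1)] test_less_following[of j] p_less j(2) \<open>following j \<le> test i\<close>
      by (intro less.hyps less.prems(3)) auto
    ultimately show ?thesis unfolding j(2) exec_test[OF j(1)] by simp
  qed
qed

lemma yields_first_nonzero_input:
  assumes "i \<in> {1..n}" "s (InReg i)" "p \<in> tests \<union> {final}" "p \<le> test i"
    and "\<And>j. j \<in> {1..n} \<Longrightarrow> p \<le> test j \<Longrightarrow> test j < test i \<Longrightarrow> \<not> s (InReg j)"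
  shows "yields X p s b \<longleftrightarrow> yields X (entry i) s b"
  unfolding yields_def using exec_first_nonzero_input[of i s p, OF assms] by simp

lemma first_nonzero_input:
  assumes "j \<in> {1..n}" "s (InReg j)" "p \<le> test j"
  obtains i where "i \<in> {1..n}" "s (InReg i)" "p \<le> test i"
    "\<And>k. k \<in> {1..n} \<Longrightarrow> p \<le> test k \<Longrightarrow> test k < test i \<Longrightarrow> \<not> s (InReg k)"
proof -
  obtain i where "i \<in> {1..n} \<and> s (InReg i) \<and> p \<le> test i"
    and "\<And>k. k \<in> {1..n} \<and> s (InReg k) \<and> p \<le> test k \<Longrightarrow> test i \<le> test k"
    using ex_has_least_nat[of "\<lambda>i. i \<in> {1..n} \<and> s (InReg i) \<and> p \<le> test i" j test] assms by blast
  then show thesis using that[of i] by (meson leD)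
qed

lemma output_unchanged_after_only_input:
  assumes "i \<in> {1..n}" "test i < p" "p \<in> tests \<union> {final}" "\<And>j. s (InReg j) \<longleftrightarrow> j = i"
    and "yields X p s b"
  shows "s OutReg = b"
proof -
  have "exec X p s s" using assms(2-4) by (intro exec_zero_inputs) auto
  then show ?thesis using yields_exec assms(5) by simp
qed

subsection \<open>The instructions at the exits\<close>

definition sets_output :: "nat \<Rightarrow> bool" where
  "sets_output q \<longleftrightarrow> X ! q = Plain (OutSet True) \<or> X ! q = PosTest (OutSet True) \<or>
     X ! q = NegTest (OutSet True) \<and> q + 2 < length X"

definition jumps_to_exit :: "nat \<Rightarrow> bool" where
  "jumps_to_exit q \<longleftrightarrow> (\<exists>l>0. X ! q = Jump l \<and> q + l \<in> exits)"

definition skips_to_exit :: "nat \<Rightarrow> store \<Rightarrow> bool" where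
  "skips_to_exit q s \<longleftrightarrow> q + 2 \<in> exits \<and>
     (\<exists>a. X ! q = PosTest a \<and> \<not> reply a s \<or> X ! q = NegTest a \<and> reply a s)"

text \<open>With a single nonzero input, all inputs read after position \<open>q\<close> are 0, so nothing but an exit
  can still produce output 1.\<close>

lemma exit_cases:
  assumes q: "q \<in> exits" and i: "i \<in> {1..n}" "test i < q"
    and yields: "yields X q (input_store {i}) True"
  shows "sets_output q \<or> jumps_to_exit q \<or> skips_to_exit q (input_store {i})"
proof -
  have not_Term: "X ! q \<noteq> Term" using yields by (auto simp: yields_Term_iff)
  have not_Jump_0: "X ! q \<noteq> Jump 0" using yields exec_not_Jump_0 by (auto simp: yields_def)
  obtain p s where nxt: "next_state (X ! q) (q, input_store {i}) = (p, s)" by (metis surj_pair)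
  have later: "q < p" using next_state_increases[OF not_Term not_Jump_0 nxt] .
  have yields': "yields X p s True" using yields yields_next_iff[OF not_Term nxt] by simp
  have p_less: "p < length X" using yields_length[OF yields'] .
  have inputs: "s (InReg j) \<longleftrightarrow> j = i" for j using next_state_InReg[OF nxt] by simp
  have sets: "s OutReg" if "p \<notin> exits"
    using output_unchanged_after_only_input[OF i(1) _ _ inputs yields'] position_cases[OF p_less]
      i(2) later that by auto
  have no_exit: "q + 1 \<notin> exits" using exit_succ[OF q] tests_disjoint_exits final_notin_exits by auto
  show ?thesis
  proof (cases "X ! q")
    case (Plain a)
    then have "s OutReg" using sets nxt no_exit by simp
    then show ?thesis using Plain nxt by (cases a) (auto simp: sets_output_def)
  next
    case (PosTest a)
    then have "\<not> reply a (input_store {i}) \<and> q + 2 \<in> exits \<or> s OutReg"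
      using sets nxt no_exit by (auto split: if_splits)
    then show ?thesis using PosTest nxt by (cases a) (auto simp: sets_output_def skips_to_exit_def)
  next
    case (NegTest a)
    then have "reply a (input_store {i}) \<and> q + 2 \<in> exits \<or> s OutReg"
      using sets nxt no_exit by (auto split: if_splits)
    then show ?thesis using NegTest nxt p_less
      by (cases a) (auto simp: sets_output_def skips_to_exit_def)
  next
    case (Jump l)
    then have "s = input_store {i}" "p = q + l" using nxt by auto
    then show ?thesis using sets later Jump by (auto simp: jumps_to_exit_def)
  qed (use not_Term in simp)
qed

end


locale passing_blocks = block_structure +
  assumes valid: "u \<in> set X \<Longrightarrow> valid_prim u"
    and passes_at: "i \<in> {1..n} \<Longrightarrow> passes_at X i"
begin

lemma yields_unit_entry:
  assumes "i \<in> {1..n}"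
  shows "yields X (entry i) (input_store {i}) True"
proof -
  have "yields X 0 (input_store {i}) True"
    using passes_at_unit passes_at[OF assms] assms by simp
  then show ?thesis
    using yields_first_nonzero_input[of i "input_store {i}" 0 True] assms start by auto
qed

lemma exit_cases_unit:
  assumes "q \<in> exits"
  shows "sets_output q \<or> jumps_to_exit q \<or> (\<exists>i. skips_to_exit q (input_store {i}))"
proof -
  obtain i where i: "i \<in> {1..n}" "q = test i + 1" "X ! test i = PosTest (InGet i)"
    using exit_pred[OF assms] by blast
  then have "entry i = q" by (simp add: entry_def)
  then show ?thesis using exit_cases[OF assms i(1)] yields_unit_entry[OF i(1)] i(2) by auto
qed

definition no_skip_from :: "nat \<Rightarrow> bool" where
  "no_skip_from p \<longleftrightarrow> (\<forall>q\<ge>p. q \<in> exits \<longrightarrow> q + 2 \<notin> exits)"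

lemma no_skip_from_after_skip: "q \<in> exits \<Longrightarrow> q + 2 \<in> exits \<Longrightarrow> q < p \<Longrightarrow> no_skip_from p"
  unfolding no_skip_from_def using skip_unique by fastforce

text \<open>Once the output is set it stays set, and an exit after which no instruction can be skipped
  leads to setting the output, whatever the store.\<close>

definition bound_to_succeed :: "nat \<Rightarrow> store \<Rightarrow> bool" where
  "bound_to_succeed p s \<longleftrightarrow> p < length X \<and> (s OutReg \<or> p \<in> exits \<and> no_skip_from p)"

lemma bound_to_succeed_step_test:
  assumes "bound_to_succeed p s" "p \<in> tests" "next_state (X ! p) (p, s) = (p', s')"
  shows "bound_to_succeed p' s'"
proof -
  obtain j where j: "j \<in> {1..n}" "p = test j" using assms(2) by auto
  have "p \<notin> exits" using assms(2) tests_disjoint_exits by blast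
  then have "s OutReg" using assms(1) by (simp add: bound_to_succeed_def)
  moreover have "p' \<in> {entry j, following j}" "s' = s"
    using test_successors[OF j(1)] assms(3) j(2)
    by (auto simp: entry_def following_def split: if_splits)
  moreover have "entry j < length X" "following j < length X"
    using exit_less_length[OF entry_exit[OF j(1)]] test_less_length[OF following_test[OF j(1)]] .
  ultimately show ?thesis by (auto simp: bound_to_succeed_def)
qed

lemma bound_to_succeed_step_exit:
  assumes "bound_to_succeed p s" "p \<in> exits" "next_state (X ! p) (p, s) = (p', s')"
  shows "bound_to_succeed p' s'"
proof -
  have p1: "p + 1 < length X" using test_less_length[OF exit_succ[OF assms(2)]] .
  from exit_cases_unit[OF assms(2)] show ?thesis
  proof (elim disjE exE)
    assume "sets_output p"
    then show ?thesis using assms(3) p1 by (auto simp: sets_output_def bound_to_succeed_def)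
  next
    assume "jumps_to_exit p"
    then show ?thesis using assms(1,3) exit_less_length
      by (auto simp: jumps_to_exit_def bound_to_succeed_def no_skip_from_def)
  next
    fix i assume skips: "skips_to_exit p (input_store {i})"
    then have p2: "p + 2 \<in> exits" by (simp add: skips_to_exit_def)
    then have "s OutReg" using assms(1,2) by (auto simp: bound_to_succeed_def no_skip_from_def)
    then have "p' = p + 2 \<or> s' OutReg \<and> p' = p + 1"
      using skips assms(3) unfolding skips_to_exit_def
      by (elim conjE exE disjE; rename_tac a; case_tac a) (auto split: if_splits)
    then show ?thesis
      using p1 p2 exit_less_length[OF p2] no_skip_from_after_skip[OF assms(2) p2, of "p + 2"]
      by (auto simp: bound_to_succeed_def)
  qed
qed

lemma bound_to_succeed_imp_yields: "bound_to_succeed p s \<Longrightarrow> yields X p s True"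
proof (induction "length X - p" arbitrary: p s rule: less_induct)
  case less
  then have p: "p < length X" by (simp add: bound_to_succeed_def)
  show ?case
  proof (cases "X ! p = Term")
    case True
    have "p \<notin> exits" using exit_cases_unit[of p] True
      by (auto simp: sets_output_def jumps_to_exit_def skips_to_exit_def)
    then show ?thesis using less.prems True by (simp add: bound_to_succeed_def yields_Term_iff)
  next
    case False
    obtain p' s' where nxt: "next_state (X ! p) (p, s) = (p', s')" by (metis surj_pair)
    have kind: "p \<in> tests \<or> p \<in> exits" using position_cases[OF p] Term_final False by blast
    then have "X ! p \<noteq> Jump 0"
      using test_reads[of p] exit_cases_unit[of p]
      by (auto simp: sets_output_def jumps_to_exit_def skips_to_exit_def)
    then have "p < p'" using next_state_increases[OF False _ nxt] by blast
    moreover have "bound_to_succeed p' s'"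
      using kind bound_to_succeed_step_test[OF less.prems _ nxt]
        bound_to_succeed_step_exit[OF less.prems _ nxt] by blast
    ultimately show ?thesis using less.hyps[of p' s'] p yields_next_iff[OF False nxt] by simp
  qed
qed

lemma critical_input_eq:
  assumes q: "q \<in> exits" "q + 2 \<in> exits" and X: "X ! q = PosTest (InGet c)"
  shows "critical_input X = c"
proof -
  obtain j where j: "q + 1 = test j" "X ! test j = PosTest (InGet j)"
    using exit_pred[OF q(2)] by auto
  have not_input_test: "X ! p \<noteq> PosTest (InGet i)" if "p \<in> exits" "q < p" for p i
    using exit_cases_unit[OF that(1)] skip_unique[OF q that(1)] that(2)
    by (auto simp: sets_output_def jumps_to_exit_def skips_to_exit_def)
  show ?thesis unfolding critical_input_def
  proof (rule last_test_pair_eq)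
    show "Suc q < length X" using exit_less_length[OF q(2)] by simp
    have "valid_prim (X ! q)" using valid exit_less_length[OF q(1)] by simp
    then show "c \<noteq> 0" using X by simp
    fix p i i' assume p: "q < p" "Suc p < length X" "X ! p = PosTest (InGet i)"
    have "p \<noteq> final" using p(2) length_eq by simp
    moreover have "p \<notin> exits" using not_input_test p(1,3) by blast
    ultimately obtain k where k: "k \<in> {1..n}" "p = test k"
      using position_cases[of p] p(2) by auto
    then have "p + 1 \<in> exits" using test_successors[OF k(1)] p(3) by auto
    then show "X ! Suc p \<noteq> PosTest (InGet i')" using not_input_test[of "Suc p"] p(1) by simp
  qed (use X j in simp_all)
qed

lemma yields_if_tests_critical_input:
  assumes q: "q \<in> exits" "q + 2 \<in> exits" and X: "X ! q = PosTest (InGet d)" and "s (InReg d)"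
    and A: "d \<in> A" "\<And>j. j \<in> A \<Longrightarrow> s (InReg j)" and yields: "yields X q (input_store A) True"
  shows "yields X q s True"
proof -
  have step: "yields X q s' True \<longleftrightarrow> yields X (q + 1) s' True" if "s' (InReg d)" for s'
    using yields_next_iff[of X q s' "q + 1" s' True] X exit_less_length[OF q(1)] that by simp
  have after_test: "yields X (q + 1) (input_store A) True" using step A(1) yields by simp
  obtain k where k: "k \<in> {1..n}" "q + 1 \<le> test k" "s (InReg k)"
  proof (rule ccontr)
    assume "\<not> thesis"
    then have "exec X (q + 1) (input_store A) (input_store A)"
      using that A(2) by (intro exec_zero_inputs exit_succ[OF q(1)]) auto
    from yields_exec[OF after_test this] show False by simp
  qed
  obtain j where j: "j \<in> {1..n}" "s (InReg j)" "q + 1 \<le> test j"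
      "\<And>k. k \<in> {1..n} \<Longrightarrow> q + 1 \<le> test k \<Longrightarrow> test k < test j \<Longrightarrow> \<not> s (InReg k)"
    using first_nonzero_input[of k s "q + 1"] k by metis
  have "bound_to_succeed (entry j) s"
    using entry_exit[OF j(1)] exit_less_length no_skip_from_after_skip[OF q, of "entry j"]
      test_less_entry[of j] j(3) by (simp add: bound_to_succeed_def)
  then have "yields X (q + 1) s True"
    using yields_first_nonzero_input[of j s "q + 1", OF j(1,2) exit_succ[OF q(1)] j(3,4)]
      bound_to_succeed_imp_yields by simp
  then show ?thesis using step assms(4) by simp
qed

lemma yields_if_skips_on_unit:
  assumes q: "q \<in> exits" and i: "test i < q" "s (InReg i)"
    and aux: "\<And>j. X ! q = PosTest (AuxGet j) \<or> X ! q = NegTest (AuxGet j) \<Longrightarrow> \<not> s (AuxReg j)"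
    and A: "A = {j \<in> {i, critical_input X} - {0}. s (InReg j)}"
    and skips: "skips_to_exit q (input_store {i})" and yields: "yields X q (input_store A) True"
  shows "yields X q s True"
proof -
  have q_less: "q < length X" using exit_less_length[OF q] .
  have q2: "q + 2 \<in> exits" using skips by (simp add: skips_to_exit_def)
  obtain a where a: "X ! q = PosTest a \<and> \<not> reply a (input_store {i}) \<or>
      X ! q = NegTest a \<and> reply a (input_store {i})"
    using skips by (auto simp: skips_to_exit_def)
  show ?thesis
  proof (cases "reply a s = reply a (input_store {i})")
    case True
    then have "next_state (X ! q) (q, s) = (q + 2, effect a s)" "X ! q \<noteq> Term" using a by auto
    moreover have "bound_to_succeed (q + 2) (effect a s)"
      using q2 exit_less_length[OF q2] no_skip_from_after_skip[OF q q2]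
      by (simp add: bound_to_succeed_def)
    ultimately show ?thesis using yields_next_iff q_less bound_to_succeed_imp_yields by simp
  next
    case False
    then obtain d where d: "a = InGet d" using a aux by (cases a) auto
    have "valid_prim (X ! q)" using valid q_less by simp
    then have "d \<noteq> 0" using a d by auto
    then have X: "X ! q = PosTest (InGet d)" and "s (InReg d)" using a False d i(2) by auto
    then have "d \<in> A" using A critical_input_eq[OF q q2 X] \<open>d \<noteq> 0\<close> by simp
    then show ?thesis
      by (rule yields_if_tests_critical_input[of q d s A, OF q q2 X \<open>s (InReg d)\<close>])
        (use A yields in simp_all)
  qed
qed

lemma yields_from_exit:
  assumes "q \<in> exits" and i: "i \<in> {1..n}" "s (InReg i)"
    and aux: "\<And>p j. p < length X \<Longrightarrow> X ! p = PosTest (AuxGet j) \<or> X ! p = NegTest (AuxGet j) \<Longrightarrow>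
      \<not> s (AuxReg j)"
    and A: "A = {j \<in> {i, critical_input X} - {0}. s (InReg j)}"
    and "test i < q" "yields X q (input_store {i}) True" "yields X q (input_store A) True"
  shows "yields X q s True"
  using assms(1,6-8)
proof (induction "length X - q" arbitrary: q rule: less_induct)
  case less
  note q = less.prems(1)
  have q_less: "q < length X" "q + 1 < length X"
    using exit_less_length[OF q] test_less_length[OF exit_succ[OF q]] .
  from exit_cases[OF q i(1) less.prems(2,3)] show ?case
  proof (elim disjE)
    assume sets: "sets_output q"
    obtain p s' where nxt: "next_state (X ! q) (q, s) = (p, s')" by (metis surj_pair)
    have "bound_to_succeed p s'" "X ! q \<noteq> Term"
      using sets nxt q_less by (auto simp: sets_output_def bound_to_succeed_def)
    then show ?thesis using yields_next_iff[OF _ nxt] bound_to_succeed_imp_yields q_less(1) by simp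
  next
    assume "jumps_to_exit q"
    then obtain l where l: "l > 0" "X ! q = Jump l" "q + l \<in> exits"
      by (auto simp: jumps_to_exit_def)
    have step: "yields X q s' b \<longleftrightarrow> yields X (q + l) s' b" for s' b
      using yields_next_iff[of X q s' "q + l" s' b] l(2) q_less(1) by simp
    have "yields X (q + l) s True"
      by (rule less.hyps) (use l q_less less.prems step in auto)
    then show ?thesis using step by simp
  next
    assume "skips_to_exit q (input_store {i})"
    then show ?thesis
      using yields_if_skips_on_unit[OF q less.prems(2) i(2) aux[OF q_less(1)] A] less.prems(4)
      by blast
  qed
qed

lemma yields_tstnz:
  assumes aux: "\<And>p j. p < length X \<Longrightarrow> X ! p = PosTest (AuxGet j) \<or> X ! p = NegTest (AuxGet j) \<Longrightarrow>
      \<not> s (AuxReg j)"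
    and "\<not> s OutReg"
  shows "yields X 0 s (\<exists>i\<in>{1..n}. s (InReg i))"
proof (cases "\<exists>i\<in>{1..n}. s (InReg i)")
  case False
  then have "exec X 0 s s" using exec_zero_inputs[OF start] by blast
  then show ?thesis using assms(2) False by (auto simp: yields_def)
next
  case True
  then obtain i where i: "i \<in> {1..n}" "s (InReg i)" "0 \<le> test i"
      "\<And>k. k \<in> {1..n} \<Longrightarrow> 0 \<le> test k \<Longrightarrow> test k < test i \<Longrightarrow> \<not> s (InReg k)"
    using first_nonzero_input[of _ s 0] by (metis le0)
  define A where "A = {j \<in> {i, critical_input X} - {0}. s (InReg j)}"
  have "A = {i, 0} - {0} \<or> A = {i, critical_input X} - {0}"
    using i(1,2) by (auto simp: A_def)
  then have "yields X 0 (input_store A) True"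
    using passes_at[OF i(1)] unfolding passes_at_def by (elim disjE) simp_all
  moreover have "yields X 0 (input_store A) True \<longleftrightarrow> yields X (entry i) (input_store A) True"
    using i by (intro yields_first_nonzero_input start) (auto simp: A_def)
  ultimately have "yields X (entry i) (input_store A) True" by simp
  then have "yields X (entry i) s True"
    by (intro yields_from_exit[OF entry_exit[OF i(1)] i(1,2) _ A_def test_less_entry
          yields_unit_entry[OF i(1)]] aux)
  then show ?thesis using yields_first_nonzero_input[of i s 0 True] i start True by simp
qed

end

subsection \<open>Computing \<open>tstnz\<close>\<close>

lemma (in correct_on_units) ex_block_structure:
  "\<exists>test exits final. block_structure X n test exits final"
  by (intro exI) (rule block_structure)

lemma tstnz_iff:
  assumes "length bs = n" "\<forall>i\<in>{1..n}. s (InReg i) = bs ! (i - 1)"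
  shows "tstnz bs \<longleftrightarrow> (\<exists>i\<in>{1..n}. s (InReg i))"
proof -
  have "tstnz bs \<longleftrightarrow> (\<exists>p<n. bs ! p)"
    using assms(1) unfolding tstnz_def by (metis (full_types) in_set_conv_nth)
  also have "\<dots> \<longleftrightarrow> (\<exists>i\<in>{1..n}. bs ! (i - 1))"
    unfolding image_Suc_lessThan[symmetric] by auto
  also have "\<dots> \<longleftrightarrow> (\<exists>i\<in>{1..n}. s (InReg i))" using assms(2) by blast
  finally show ?thesis .
qed

lemma ex_aux_bound:
  "\<exists>k. \<forall>j. PosTest (AuxGet j) \<in> set X \<or> NegTest (AuxGet j) \<in> set X \<longrightarrow> j \<le> k"
proof -
  have "finite ((\<lambda>j. PosTest (AuxGet j)) -` set X)" "finite ((\<lambda>j. NegTest (AuxGet j)) -` set X)"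
    by (simp_all add: finite_vimageI inj_def)
  then have "finite ((\<lambda>j. PosTest (AuxGet j)) -` set X \<union> (\<lambda>j. NegTest (AuxGet j)) -` set X)" by simp
  then show ?thesis unfolding finite_nat_set_iff_bounded_le by auto
qed

lemma passes_imp_computes:
  assumes X: "X \<in> IS" "length X = L n" and passes: "passes X n"
  shows "computes X n tstnz"
proof -
  have at: "passes_at X i" if "i \<in> {1..n}" for i using passes that by (simp add: passes_def)
  interpret correct_on_units X n
  proof
    show "yields X 0 (input_store {}) False" using passes by (simp add: passes_def)
  qed (use X(2) passes_at_unit at in simp_all)
  obtain test exits final where "block_structure X n test exits final"
    using ex_block_structure by blast
  then interpret blocks: block_structure X n test exits final .
  interpret blocks: passing_blocks X n test exits final
    by unfold_locales (use X(1) at in \<open>simp_all add: IS_def\<close>)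
  obtain k where k: "\<And>j. PosTest (AuxGet j) \<in> set X \<or> NegTest (AuxGet j) \<in> set X \<Longrightarrow> j \<le> k"
    using ex_aux_bound by blast
  show ?thesis unfolding computes_def
  proof (intro exI[of _ k] allI impI; elim conjE)
    fix bs s
    assume bs: "length bs = n" "\<forall>i\<in>{1..n}. s (InReg i) = bs ! (i - 1)"
      and s: "s OutReg = False" "\<forall>i\<in>{1..k}. s (AuxReg i) = False"
    have "\<not> s (AuxReg j)"
      if p: "p < length X" "X ! p = PosTest (AuxGet j) \<or> X ! p = NegTest (AuxGet j)" for p j
    proof -
      have "X ! p \<in> set X" using p(1) by simp
      then have "j \<le> k" "1 \<le> j" using k[of j] blocks.valid[of "X ! p"] p(2) by auto
      then show ?thesis using s(2) by simp
    qed
    then show "\<exists>s'. exec X 0 s s' \<and> s' OutReg = tstnz bs"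
      using blocks.yields_tstnz[of s] s(1) unfolding tstnz_iff[OF bs] yields_def by simp
  qed
qed

lemma computes_imp_passes:
  assumes "computes X n tstnz"
  shows "passes X n"
proof -
  have yields: "yields X 0 (input_store A) (\<exists>j\<in>{1..n}. j \<in> A)" for A
  proof -
    let ?bs = "map (\<lambda>j. Suc j \<in> A) [0..<n]"
    have bs: "length ?bs = n" "\<forall>i\<in>{1..n}. input_store A (InReg i) = ?bs ! (i - 1)" by auto
    obtain k where "\<forall>bs s. length bs = n \<and> (\<forall>i\<in>{1..n}. s (InReg i) = bs ! (i - 1)) \<and>
        s OutReg = False \<and> (\<forall>i\<in>{1..k}. s (AuxReg i) = False) \<longrightarrow> yields X 0 s (tstnz bs)"
      using assms unfolding computes_def yields_def by blast
    from this[rule_format, of ?bs "input_store A"] bs have "yields X 0 (input_store A) (tstnz ?bs)"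
      by simp
    then show ?thesis using tstnz_iff[OF bs] by simp
  qed
  have "yields X 0 (input_store {}) False" using yields[of "{}"] by simp
  moreover have "yields X 0 (input_store ({i, c} - {0})) True" if "i \<in> {1..n}" for i c
  proof -
    have "(\<exists>j\<in>{1..n}. j \<in> {i, c} - {0}) = True" using that by auto
    then show ?thesis using yields[of "{i, c} - {0}"] by simp
  qed
  ultimately show ?thesis by (simp add: passes_def passes_at_def)
qed

theorem computes_tstnz_iff_passes:
  "X \<in> IS \<Longrightarrow> length X = L n \<Longrightarrow> computes X n tstnz \<longleftrightarrow> passes X n"
  using passes_imp_computes computes_imp_passes by blast

section \<open>Structured random access machine programs\<close>

type_synonym state = "(nat \<Rightarrow> int) \<times> int list \<times> int list"

text \<open>The only jump of the machine is conditional; the cell \<open>ONE\<close> serves as the condition of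
  unconditional jumps and must be positive then.\<close>

abbreviation (input) "ONE \<equiv> 2 :: nat"

datatype com =
    Block "ram_instr list"
  | Seq com com (infixr ";;" 60)
  | If nat com com ("(IF _/ THEN _/ ELSE _)" [0, 0, 61] 61)
  | While nat com ("(WHILE _/ DO _)" [0, 61] 61)

primrec com_size :: "com \<Rightarrow> nat" where
  "com_size (Block is) = length is"
| "com_size (c ;; d) = com_size c + com_size d"
| "com_size (IF j THEN c ELSE d) = com_size c + com_size d + 2"
| "com_size (WHILE j DO c) = com_size c + 3"

primrec compile :: "com \<Rightarrow> nat \<Rightarrow> ram_program" where
  "compile (Block is) k = is"
| "compile (c ;; d) k = compile c k @ compile d (k + com_size c)"
| "compile (IF j THEN c ELSE d) k =
     [RTra (k + com_size d + 2) j] @ compile d (k + 1) @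
     [RTra (k + com_size d + com_size c + 2) ONE] @ compile c (k + com_size d + 2)"
| "compile (WHILE j DO c) k =
     [RTra (k + 2) j] @ [RTra (k + com_size c + 3) ONE] @ compile c (k + 2) @ [RTra k ONE]"

lemma length_compile [simp]: "length (compile c k) = com_size c"
  by (induction c arbitrary: k) simp_all

fun eval_instr :: "ram_instr \<Rightarrow> state \<Rightarrow> state option" where
  "eval_instr (RConst i c) (m, io) = Some (m(i := c), io)"
| "eval_instr (RAdd i j k) (m, io) = Some (m(i := m j + m k), io)"
| "eval_instr (RSub i j k) (m, io) = Some (m(i := m j - m k), io)"
| "eval_instr (RLoad i j) (m, io) = (if m j < 0 then None else Some (m(i := m (nat (m j))), io))"
| "eval_instr (RStore i j) (m, io) = (if m i < 0 then None else Some (m(nat (m i) := m j), io))"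
| "eval_instr (RTra l j) (m, io) = None"
| "eval_instr (RRead i) (m, [], ys) = None"
| "eval_instr (RRead i) (m, x # xs, ys) = Some (m(i := x), xs, ys)"
| "eval_instr (RPrint i) (m, xs, ys) = Some (m, xs, ys @ [m i])"

fun eval_block :: "ram_instr list \<Rightarrow> state \<Rightarrow> state option" where
  "eval_block [] s = Some s"
| "eval_block (i # is) s = Option.bind (eval_instr i s) (eval_block is)"

inductive runs :: "com \<Rightarrow> state \<Rightarrow> nat \<Rightarrow> state \<Rightarrow> bool" where
  runs_Block: "eval_block is s = Some s' \<Longrightarrow> runs (Block is) s (length is) s'"
| runs_Seq: "runs c s t s' \<Longrightarrow> runs d s' u s'' \<Longrightarrow> runs (c ;; d) s (t + u) s''"
| runs_IfTrue: "0 < fst s j \<Longrightarrow> runs c s t s' \<Longrightarrow> runs (IF j THEN c ELSE d) s (t + 1) s'"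
| runs_IfFalse: "fst s j \<le> 0 \<Longrightarrow> runs d s t s' \<Longrightarrow> 0 < fst s' ONE \<Longrightarrow>
    runs (IF j THEN c ELSE d) s (t + 2) s'"
| runs_WhileFalse: "fst s j \<le> 0 \<Longrightarrow> 0 < fst s ONE \<Longrightarrow> runs (WHILE j DO c) s 2 s"
| runs_WhileTrue: "0 < fst s j \<Longrightarrow> runs c s t s' \<Longrightarrow> 0 < fst s' ONE \<Longrightarrow>
    runs (WHILE j DO c) s' u s'' \<Longrightarrow> runs (WHILE j DO c) s (t + u + 2) s''"
| runs_mono: "runs c s t s' \<Longrightarrow> t \<le> u \<Longrightarrow> runs c s u s'"

subsection \<open>Correctness of compilation\<close>

definition config :: "nat \<Rightarrow> state \<Rightarrow> ram_config" where
  "config k s = \<lparr>ram_pc = k, ram_mem = fst s, ram_inp = fst (snd s), ram_out = snd (snd s)\<rparr>"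

definition reaches :: "ram_program \<Rightarrow> nat \<Rightarrow> ram_config \<Rightarrow> ram_config \<Rightarrow> bool" where
  "reaches P t \<sigma> \<sigma>' \<longleftrightarrow> (\<exists>u\<le>t. ram_steps P u \<sigma> = Some \<sigma>')"

lemma reaches_refl: "reaches P t \<sigma> \<sigma>"
  unfolding reaches_def by (intro exI[of _ 0]) simp

lemma reaches_mono: "reaches P t \<sigma> \<sigma>' \<Longrightarrow> t \<le> u \<Longrightarrow> reaches P u \<sigma> \<sigma>'"
  unfolding reaches_def using order_trans by blast

lemma reaches_step: "ram_step P \<sigma> = Some \<sigma>' \<Longrightarrow> reaches P t \<sigma>' \<sigma>'' \<Longrightarrow> reaches P (Suc t) \<sigma> \<sigma>''"
  unfolding reaches_def by (metis bind.bind_lunit not_less_eq_eq ram_steps.simps(2))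

lemma ram_steps_add: "ram_steps P (t + u) \<sigma> = Option.bind (ram_steps P t \<sigma>) (ram_steps P u)"
  by (induction t arbitrary: \<sigma>) (simp_all, metis bind_assoc)

lemma reaches_trans:
  assumes "reaches P t \<sigma> \<sigma>'" "reaches P u \<sigma>' \<sigma>''" "t + u \<le> v"
  shows "reaches P v \<sigma> \<sigma>''"
proof -
  obtain t' u' where "t' \<le> t" "u' \<le> u" "ram_steps P t' \<sigma> = Some \<sigma>'" "ram_steps P u' \<sigma>' = Some \<sigma>''"
    using assms by (auto simp: reaches_def)
  then have "t' + u' \<le> v" "ram_steps P (t' + u') \<sigma> = Some \<sigma>''"
    using assms(3) by (auto simp: ram_steps_add)
  then show ?thesis unfolding reaches_def by blast
qed

definition code_at :: "ram_program \<Rightarrow> nat \<Rightarrow> ram_program \<Rightarrow> bool" where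
  "code_at P k Q \<longleftrightarrow> (\<exists>ys zs. P = ys @ Q @ zs \<and> length ys = k)"

lemma code_at_append: "code_at P k (Q @ Q') \<longleftrightarrow> code_at P k Q \<and> code_at P (k + length Q) Q'"
proof
  assume "code_at P k (Q @ Q')"
  then obtain ys zs where "P = ys @ Q @ Q' @ zs" "length ys = k" by (auto simp: code_at_def)
  then show "code_at P k Q \<and> code_at P (k + length Q) Q'"
    unfolding code_at_def by (metis append.assoc length_append)
next
  assume "code_at P k Q \<and> code_at P (k + length Q) Q'"
  then obtain ys zs ys' zs' where "P = ys @ Q @ zs" "length ys = k"
      and "P = ys' @ Q' @ zs'" "length ys' = k + length Q"
    unfolding code_at_def by blast
  then have "P = ys @ (Q @ Q') @ zs'"
    by (metis append.assoc append_eq_append_conv length_append)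
  then show "code_at P k (Q @ Q')" unfolding code_at_def using \<open>length ys = k\<close> by blast
qed

lemma code_at_Cons: "code_at P k (i # Q) \<longleftrightarrow> code_at P k [i] \<and> code_at P (k + 1) Q"
  using code_at_append[of P k "[i]" Q] by simp

lemma ram_step_code_at: "code_at P k [i] \<Longrightarrow> ram_step P (config k s) = ram_exec i (config k s)"
  by (auto simp: code_at_def ram_step_def config_def)

lemma ram_exec_eval_instr:
  "eval_instr i s = Some s' \<Longrightarrow> ram_exec i (config k s) = Some (config (k + 1) s')"
  by (induction i s rule: eval_instr.induct) (auto simp: config_def split: if_splits)

lemma reaches_instr:
  "code_at P k [i] \<Longrightarrow> eval_instr i s = Some s' \<Longrightarrow> reaches P 1 (config k s) (config (k + 1) s')"
  using reaches_step[OF _ reaches_refl] by (simp add: ram_step_code_at ram_exec_eval_instr)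

lemma reaches_RTra:
  assumes "code_at P k [RTra l j]"
  shows "reaches P 1 (config k s) (config (if 0 < fst s j then l else k + 1) s)"
proof -
  have "ram_step P (config k s) = Some (config (if 0 < fst s j then l else k + 1) s)"
    unfolding ram_step_code_at[OF assms] by (simp add: config_def)
  then show ?thesis using reaches_step[OF _ reaches_refl] by simp
qed

lemma reaches_eval_block:
  "code_at P k is \<Longrightarrow> eval_block is s = Some s' \<Longrightarrow>
    reaches P (length is) (config k s) (config (k + length is) s')"
proof (induction "is" arbitrary: k s)
  case (Cons i "is")
  then obtain s1 where "eval_instr i s = Some s1" "eval_block is s1 = Some s'"
    by (auto simp: bind_eq_Some_conv)
  moreover have "code_at P k [i]" "code_at P (k + 1) is"
    using Cons.prems(1) by (simp_all add: code_at_Cons[of P k i "is"])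
  ultimately have "reaches P 1 (config k s) (config (k + 1) s1)"
    and "reaches P (length is) (config (k + 1) s1) (config (k + length (i # is)) s')"
    using reaches_instr Cons.IH[of "k + 1" s1] by simp_all
  then show ?case by (rule reaches_trans) simp
qed (simp add: reaches_refl)

definition executes :: "ram_program \<Rightarrow> com \<Rightarrow> state \<Rightarrow> nat \<Rightarrow> state \<Rightarrow> bool" where
  "executes P c s t s' \<longleftrightarrow> (\<forall>k. code_at P k (compile c k) \<longrightarrow>
     reaches P t (config k s) (config (k + com_size c) s'))"

lemma executesI:
  assumes "\<And>k. code_at P k (compile c k) \<Longrightarrow> reaches P t (config k s) (config (k + com_size c) s')"
  shows "executes P c s t s'"
  using assms by (simp add: executes_def)

lemma executesD:
  "executes P c s t s' \<Longrightarrow> code_at P k (compile c k) \<Longrightarrow>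
    reaches P t (config k s) (config (k + com_size c) s')"
  by (simp add: executes_def)

lemma executes_Seq:
  assumes "executes P c s t s'" "executes P d s' u s''"
  shows "executes P (c ;; d) s (t + u) s''"
proof (rule executesI)
  fix k assume "code_at P k (compile (c ;; d) k)"
  then have "code_at P k (compile c k)" "code_at P (k + com_size c) (compile d (k + com_size c))"
    by (simp_all add: code_at_append)
  from executesD[OF assms(1) this(1)] executesD[OF assms(2) this(2)]
  have "reaches P (t + u) (config k s) (config (k + com_size c + com_size d) s'')"
    by (rule reaches_trans) simp
  then show "reaches P (t + u) (config k s) (config (k + com_size (c ;; d)) s'')"
    by (simp add: add.assoc)
qed

lemma executes_IfTrue:
  assumes "0 < fst s j" "executes P c s t s'"
  shows "executes P (IF j THEN c ELSE d) s (t + 1) s'"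
proof (rule executesI)
  fix k assume code: "code_at P k (compile (IF j THEN c ELSE d) k)"
  let ?then = "k + com_size d + 2"
  have "code_at P k [RTra ?then j]" and body: "code_at P ?then (compile c ?then)"
    using code unfolding compile.simps code_at_append by simp_all
  from reaches_RTra[OF this(1), of s] have "reaches P 1 (config k s) (config ?then s)"
    using assms(1) by simp
  then have "reaches P (t + 1) (config k s) (config (?then + com_size c) s')"
    using executesD[OF assms(2) body] by (rule reaches_trans) simp
  then show "reaches P (t + 1) (config k s) (config (k + com_size (IF j THEN c ELSE d)) s')"
    by (simp add: ac_simps)
qed

lemma executes_IfFalse:
  assumes "fst s j \<le> 0" "executes P d s t s'" "0 < fst s' ONE"
  shows "executes P (IF j THEN c ELSE d) s (t + 2) s'"
proof (rule executesI)
  fix k assume code: "code_at P k (compile (IF j THEN c ELSE d) k)"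
  let ?end = "k + com_size d + com_size c + 2"
  have "code_at P k [RTra (k + com_size d + 2) j]"
    and body: "code_at P (k + 1) (compile d (k + 1))"
    and jump: "code_at P (k + 1 + com_size d) [RTra ?end ONE]"
    using code unfolding compile.simps code_at_append by simp_all
  from reaches_RTra[OF this(1), of s] have "reaches P 1 (config k s) (config (k + 1) s)"
    using assms(1) by simp
  then have "reaches P (t + 1) (config k s) (config (k + 1 + com_size d) s')"
    using executesD[OF assms(2) body] by (rule reaches_trans) simp
  moreover have "reaches P 1 (config (k + 1 + com_size d) s') (config ?end s')"
    using reaches_RTra[OF jump, of s'] assms(3) by simp
  ultimately have "reaches P (t + 2) (config k s) (config ?end s')" by (rule reaches_trans) simp
  then show "reaches P (t + 2) (config k s) (config (k + com_size (IF j THEN c ELSE d)) s')"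
    by (simp add: ac_simps)
qed

lemma executes_WhileFalse:
  assumes "fst s j \<le> 0" "0 < fst s ONE"
  shows "executes P (WHILE j DO c) s 2 s"
proof (rule executesI)
  fix k assume code: "code_at P k (compile (WHILE j DO c) k)"
  let ?end = "k + com_size c + 3"
  have test: "code_at P k [RTra (k + 2) j]" and jump: "code_at P (k + 1) [RTra ?end ONE]"
    using code unfolding compile.simps code_at_append by simp_all
  have "reaches P 1 (config k s) (config (k + 1) s)"
    using reaches_RTra[OF test, of s] assms(1) by simp
  moreover have "reaches P 1 (config (k + 1) s) (config ?end s)"
    using reaches_RTra[OF jump, of s] assms(2) by simp
  ultimately have "reaches P 2 (config k s) (config ?end s)" by (rule reaches_trans) simp
  then show "reaches P 2 (config k s) (config (k + com_size (WHILE j DO c)) s)"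
    by (simp add: ac_simps)
qed

lemma executes_WhileTrue:
  assumes "0 < fst s j" "executes P c s t s'" "0 < fst s' ONE" "executes P (WHILE j DO c) s' u s''"
  shows "executes P (WHILE j DO c) s (t + u + 2) s''"
proof (rule executesI)
  fix k assume code: "code_at P k (compile (WHILE j DO c) k)"
  have test: "code_at P k [RTra (k + 2) j]" and body: "code_at P (k + 2) (compile c (k + 2))"
    and jump: "code_at P (k + 2 + com_size c) [RTra k ONE]"
    using code unfolding compile.simps code_at_append by simp_all
  have "reaches P 1 (config k s) (config (k + 2) s)"
    using reaches_RTra[OF test, of s] assms(1) by simp
  then have "reaches P (t + 1) (config k s) (config (k + 2 + com_size c) s')"
    using executesD[OF assms(2) body] by (rule reaches_trans) simp
  moreover have "reaches P 1 (config (k + 2 + com_size c) s') (config k s')"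
    using reaches_RTra[OF jump, of s'] assms(3) by simp
  ultimately have "reaches P (t + 2) (config k s) (config k s')" by (rule reaches_trans) simp
  then show "reaches P (t + u + 2) (config k s) (config (k + com_size (WHILE j DO c)) s'')"
    using executesD[OF assms(4) code] by (rule reaches_trans) simp
qed

theorem runs_imp_executes: "runs c s t s' \<Longrightarrow> executes P c s t s'"
proof (induction rule: runs.induct)
  case (runs_Block "is" s s')
  then show ?case using reaches_eval_block by (simp add: executes_def)
next
  case (runs_mono c s t s' u)
  then show ?case unfolding executes_def by (blast intro: reaches_mono)
qed (blast intro: executes_Seq executes_IfTrue executes_IfFalse executes_WhileFalse
    executes_WhileTrue)+

corollary runs_outputs:
  assumes "runs c (\<lambda>_. 0, xs, []) t (m, xs', ys)"
  shows "ram_outputs_in_time (compile c 0) xs t ys"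
proof -
  have "code_at (compile c 0) 0 (compile c 0)"
    unfolding code_at_def by (intro exI[of _ "[]"]) simp
  from executesD[OF runs_imp_executes[OF assms] this] show ?thesis
    by (auto simp: reaches_def ram_outputs_in_time_def ram_init_def config_def)
qed

subsection \<open>Commands without loops, and loops with a variant\<close>

primrec eval :: "com \<Rightarrow> state \<Rightarrow> state option" where
  "eval (Block is) s = eval_block is s"
| "eval (c ;; d) s = Option.bind (eval c s) (eval d)"
| "eval (IF j THEN c ELSE d) s =
     (if 0 < fst s j then eval c s
      else Option.bind (eval d s) (\<lambda>s'. if 0 < fst s' ONE then Some s' else None))"
| "eval (WHILE j DO c) s = None"

text \<open>Without loops every line is executed at most once.\<close>

lemma runs_eval: "eval c s = Some s' \<Longrightarrow> runs c s (com_size c) s'"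
proof (induction c arbitrary: s s')
  case (Block "is")
  then show ?case by (simp add: runs_Block)
next
  case (Seq c d)
  then obtain s1 where "eval c s = Some s1" "eval d s1 = Some s'"
    by (auto simp: bind_eq_Some_conv)
  then show ?case using runs_Seq[OF Seq.IH] by simp
next
  case (If j c d)
  show ?case
  proof (cases "0 < fst s j")
    case True
    then have "runs (IF j THEN c ELSE d) s (com_size c + 1) s'"
      using If by (intro runs_IfTrue) simp_all
    then show ?thesis by (rule runs_mono) simp
  next
    case False
    then have "runs (IF j THEN c ELSE d) s (com_size d + 2) s'"
      using If by (intro runs_IfFalse) (auto simp: bind_eq_Some_conv split: if_splits)
    then show ?thesis by (rule runs_mono) simp
  qed
qed simp

lemma runs_While:
  assumes "I v s"
    and "\<And>v s. I v s \<Longrightarrow> 0 < fst s ONE"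
    and "\<And>v s. I v s \<Longrightarrow> 0 < fst s j \<Longrightarrow> \<exists>s' w. runs c s t s' \<and> I w s' \<and> w < v"
  shows "\<exists>s' w. runs (WHILE j DO c) s (v * (t + 2) + 2) s' \<and> I w s' \<and> fst s' j \<le> 0"
  using assms(1)
proof (induction v arbitrary: s rule: less_induct)
  case (less v)
  show ?case
  proof (cases "0 < fst s j")
    case False
    then have "runs (WHILE j DO c) s 2 s" using runs_WhileFalse assms(2) less.prems by simp
    then have "runs (WHILE j DO c) s (v * (t + 2) + 2) s" by (rule runs_mono) simp
    then show ?thesis using less.prems False by (meson not_less)
  next
    case True
    then obtain s1 v1 where body: "runs c s t s1" "I v1 s1" "v1 < v"
      using assms(3) less.prems by blast
    then obtain s' w where rest: "runs (WHILE j DO c) s1 (v1 * (t + 2) + 2) s'" "I w s'"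
        "fst s' j \<le> 0"
      using less.IH by blast
    have "runs (WHILE j DO c) s (t + (v1 * (t + 2) + 2) + 2) s'"
      using runs_WhileTrue[OF True body(1) _ rest(1)] assms(2)[OF body(2)] by simp
    moreover have "(v1 + 1) * (t + 2) \<le> v * (t + 2)"
      using body(3) by (intro mult_le_mono1) simp
    ultimately have "runs (WHILE j DO c) s (v * (t + 2) + 2) s'"
      by (elim runs_mono) simp
    then show ?thesis using rest by blast
  qed
qed

lemma runs_While_mem:
  assumes "I v m"
    and "\<And>v m. I v m \<Longrightarrow> 0 < m ONE"
    and "\<And>v m. I v m \<Longrightarrow> 0 < m j \<Longrightarrow> \<exists>m' w. runs c (m, io) t (m', io) \<and> I w m' \<and> w < v"
  shows "\<exists>m' w. runs (WHILE j DO c) (m, io) (v * (t + 2) + 2) (m', io) \<and> I w m' \<and> m' j \<le> 0"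
proof -
  have "\<exists>s' w. runs (WHILE j DO c) (m, io) (v * (t + 2) + 2) s' \<and>
      (\<exists>m'. s' = (m', io) \<and> I w m') \<and> fst s' j \<le> 0"
    by (rule runs_While) (use assms in \<open>fastforce+\<close>)
  then show ?thesis by fastforce
qed

section \<open>The decision program\<close>

text \<open>Named cells are numbered by lifetime, so that frame conditions take the form
  \<open>\<forall>x\<le>k. m' x = m x\<close>. The instruction at position \<open>p\<close> has its form in cell \<open>200 + 4p\<close> and its
  parameter in cell \<open>201 + 4p\<close>, and register \<open>r\<close> is cell \<open>reg_cell r\<close>. Since instructions on \<open>out\<close>
  are encoded with the parameter \<open>-1\<close>, the address of every register other than \<open>in:i\<close> is 207
  plus four times the parameter. A register holds 1 iff its cell contains the current stamp, so
  raising the stamp resets all of them at once.\<close>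

abbreviation (input) "ZERO \<equiv> 0 :: nat"
abbreviation (input) "COUNT \<equiv> 3 :: nat"
abbreviation (input) "LIMIT \<equiv> 4 :: nat"
abbreviation (input) "CRITICAL \<equiv> 5 :: nat"
abbreviation (input) "INDEX \<equiv> 6 :: nat"
abbreviation (input) "PASSED \<equiv> 7 :: nat"
abbreviation (input) "SECOND \<equiv> 8 :: nat"
abbreviation (input) "STAMP \<equiv> 9 :: nat"
abbreviation (input) "RESULT \<equiv> 10 :: nat"
abbreviation (input) "RUNNING \<equiv> 11 :: nat"
abbreviation (input) "POS \<equiv> 12 :: nat"
abbreviation (input) "FORM \<equiv> 13 :: nat"
abbreviation (input) "PARAM \<equiv> 14 :: nat"
abbreviation (input) "ADDR \<equiv> 15 :: nat"
abbreviation (input) "TMP \<equiv> 16 :: nat"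
abbreviation (input) "ON_TRUE \<equiv> 17 :: nat"
abbreviation (input) "ON_FALSE \<equiv> 18 :: nat"
abbreviation (input) "PREVIOUS \<equiv> 19 :: nat"
abbreviation (input) "OLDER \<equiv> 20 :: nat"

fun reg_cell :: "reg \<Rightarrow> nat" where
  "reg_cell (InReg i) = 202 + 4 * i"
| "reg_cell OutReg = 203"
| "reg_cell (AuxReg i) = 207 + 4 * i"

subsection \<open>Simulation of an instruction sequence\<close>

definition fetch :: com where
  "fetch = Block [RLoad FORM POS, RAdd ADDR POS ONE, RLoad PARAM ADDR]"

text \<open>Tests have 6 or 12 added to the form of the basic instruction. \<open>ON_TRUE\<close> and \<open>ON_FALSE\<close> are
  the address increments for the two replies.\<close>

definition decode_test :: com where
  "decode_test =
     Block [RConst ON_TRUE 4, RConst ON_FALSE 4, RConst TMP 5, RSub TMP FORM TMP] ;;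
     IF TMP THEN
       Block [RConst TMP 11, RSub TMP FORM TMP] ;;
       IF TMP THEN Block [RConst ON_TRUE 8, RConst TMP 12, RSub FORM FORM TMP]
       ELSE Block [RConst ON_FALSE 8, RConst TMP 6, RSub FORM FORM TMP]
     ELSE Block []"

text \<open>Modulo 3, the form of a basic instruction is 0 for get and 1 or 2 for setting to 0 or 1. Since
  the reply to a set is the new content, the reply is always read from the register at the end.\<close>

definition perform_basic :: com where
  "perform_basic =
     Block [RAdd ADDR PARAM PARAM, RAdd ADDR ADDR ADDR, RConst TMP 202] ;;
     IF FORM THEN Block [RConst TMP 207] ELSE Block [] ;;
     Block [RAdd ADDR ADDR TMP, RConst TMP 2, RSub TMP FORM TMP] ;;
     IF TMP THEN Block [RConst TMP 3, RSub FORM FORM TMP] ELSE Block [] ;;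
     IF FORM THEN
       Block [RSub TMP FORM ONE] ;;
       IF TMP THEN Block [RStore ADDR STAMP] ELSE Block [RStore ADDR ZERO]
     ELSE Block [] ;;
     Block [RLoad TMP ADDR, RSub TMP STAMP TMP] ;;
     IF TMP THEN Block [RAdd POS POS ON_FALSE] ELSE Block [RAdd POS POS ON_TRUE]"

definition jump :: com where
  "jump =
     IF PARAM THEN Block [RAdd TMP PARAM PARAM, RAdd TMP TMP TMP, RAdd POS POS TMP]
     ELSE Block [RConst RUNNING 0]"

definition terminate :: com where
  "terminate =
     Block [RConst RUNNING 0, RSub TMP STAMP (reg_cell OutReg)] ;;
     IF TMP THEN Block [RConst RESULT (-1)] ELSE Block [RConst RESULT 1]"

definition dispatch :: com where
  "dispatch =
     Block [RConst TMP 17, RSub TMP FORM TMP] ;;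
     IF TMP THEN
       Block [RSub TMP TMP ONE] ;;
       IF TMP THEN terminate ELSE jump
     ELSE
       (decode_test ;; perform_basic)"

definition simulate_step :: com where
  "simulate_step =
     Block [RSub TMP LIMIT POS] ;;
     IF TMP THEN fetch ;; dispatch ELSE Block [RConst RUNNING 0]"

text \<open>The index 0 leads to the cell of the nonexistent register \<open>in:0\<close>, which is cleared again.\<close>

definition set_up :: com where
  "set_up =
     Block [RAdd STAMP STAMP ONE, RConst TMP 202,
       RAdd ADDR INDEX INDEX, RAdd ADDR ADDR ADDR, RAdd ADDR ADDR TMP, RStore ADDR STAMP,
       RAdd ADDR SECOND SECOND, RAdd ADDR ADDR ADDR, RAdd ADDR ADDR TMP, RStore ADDR STAMP,
       RConst (reg_cell (InReg 0)) 0, RConst POS 200, RConst RUNNING 1, RConst RESULT 0]"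

definition simulate :: com where
  "simulate = set_up ;; WHILE RUNNING DO simulate_step"

definition loaded :: "prim list \<Rightarrow> (nat \<Rightarrow> int) \<Rightarrow> bool" where
  "loaded X m \<longleftrightarrow> m ZERO = 0 \<and> m ONE = 1 \<and> m LIMIT = 200 + 4 * int (length X) \<and>
     m CRITICAL = int (critical_input X) \<and>
     (\<forall>p<length X. m (200 + 4 * p) = prim_form (X ! p) \<and> m (201 + 4 * p) = prim_param (X ! p)) \<and>
     0 \<le> m STAMP \<and> (\<forall>r. m (reg_cell r) \<le> m STAMP)"

definition represents :: "(nat \<Rightarrow> int) \<Rightarrow> store \<Rightarrow> bool" where
  "represents m s \<longleftrightarrow> 0 < m STAMP \<and> (\<forall>r. s r \<longleftrightarrow> m (reg_cell r) = m STAMP)"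

fun write_effect :: "basic \<Rightarrow> (nat \<Rightarrow> int) \<Rightarrow> nat \<Rightarrow> int" where
  "write_effect (OutSet b) m = m(reg_cell OutReg := if b then m STAMP else 0)"
| "write_effect (AuxSet i b) m = m(reg_cell (AuxReg i) := if b then m STAMP else 0)"
| "write_effect (InGet i) m = m"
| "write_effect (AuxGet i) m = m"

lemma reg_cell_gt [simp]: "x < 202 \<Longrightarrow> x < reg_cell r"
  by (cases r) auto

lemma reg_cell_mod: "reg_cell r mod 4 = 2 \<or> reg_cell r mod 4 = 3"
  by (cases r; simp; presburger)

lemma reg_cell_neq [simp]:
  "x < 202 \<Longrightarrow> reg_cell r \<noteq> x" "x < 202 \<Longrightarrow> x \<noteq> reg_cell r"
  "reg_cell r \<noteq> 200 + 4 * p" "reg_cell r \<noteq> 201 + 4 * p"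
  "200 + 4 * p \<noteq> reg_cell r" "201 + 4 * p \<noteq> reg_cell r"
  using reg_cell_gt[of x r] reg_cell_mod[of r] by (auto, presburger+)

lemma reg_cell_inject [simp]: "reg_cell r = reg_cell r' \<longleftrightarrow> r = r'"
  by (cases r; cases r') (simp_all, presburger+)

lemma nat_cells:
  "nat (200 + 4 * int p) = 200 + 4 * p" "nat (201 + 4 * int p) = 201 + 4 * p"
  "nat (4 * int i + 202) = 202 + 4 * i" "nat (4 * int i + 207) = 207 + 4 * i"
  by simp_all

lemma loaded_cong:
  assumes "loaded X m" "\<And>x. x < RESULT \<or> OLDER < x \<Longrightarrow> m' x = m x"
  shows "loaded X m'"
  using assms unfolding loaded_def by simp

lemma represents_cong:
  assumes "represents m s" "\<And>x. x < RESULT \<or> OLDER < x \<Longrightarrow> m' x = m x"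
  shows "represents m' s"
  using assms unfolding represents_def by simp

lemma write_effect_below: "x < 202 \<Longrightarrow> write_effect a m x = m x"
  by (cases a) simp_all

lemma loaded_write_effect: "loaded X m \<Longrightarrow> loaded X (write_effect a m)"
  unfolding loaded_def by (cases a) (auto simp del: reg_cell.simps)

lemma represents_write_effect: "represents m s \<Longrightarrow> represents (write_effect a m) (effect a s)"
  unfolding represents_def by (cases a) (auto simp del: reg_cell.simps)

lemma eval_decode_test:
  assumes "m ONE = 1" "m FORM = 6 * int k + b" "k < 3" "0 \<le> b" "b < 6"
  shows "\<exists>m'. eval decode_test (m, io) = Some (m', io) \<and> m' FORM = b \<and>
    m' ON_TRUE = (if k = 2 then 8 else 4) \<and> m' ON_FALSE = (if k = 1 then 8 else 4) \<and>
    (\<forall>x. x \<le> POS \<or> x = PARAM \<or> OLDER < x \<longrightarrow> m' x = m x)"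
proof -
  consider "k = 0" | "k = 1" | "k = 2" using assms(3) by linarith
  then show ?thesis
    by cases (use assms in \<open>simp_all add: decode_test_def\<close>)
qed

lemma eval_perform_basic:
  assumes "loaded X m" "represents m s" "m FORM = basic_form a" "m PARAM = basic_param a"
  shows "\<exists>m'. eval perform_basic (m, io) = Some (m', io) \<and>
    m' POS = m POS + (if reply a s then m ON_TRUE else m ON_FALSE) \<and>
    (\<forall>x. x \<le> RUNNING \<or> OLDER < x \<longrightarrow> m' x = write_effect a m x)"
proof -
  have bounds: "m (202 + 4 * i) \<le> m STAMP" "m (207 + 4 * i) \<le> m STAMP" for i
    using assms(1) unfolding loaded_def by (metis reg_cell.simps)+
  have content: "s (InReg i) \<longleftrightarrow> m (202 + 4 * i) = m STAMP"
      "s (AuxReg i) \<longleftrightarrow> m (207 + 4 * i) = m STAMP" for i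
    using assms(2) unfolding represents_def by (metis reg_cell.simps)+
  have constants: "m ZERO = 0" "m ONE = 1" "0 < m STAMP"
    using assms(1,2) by (simp_all add: loaded_def represents_def)
  show ?thesis
  proof (cases a)
    case (InGet i)
    then show ?thesis using assms(3,4) constants content[of i] bounds(1)[of i]
      by (simp add: perform_basic_def nat_cells)
  next
    case (OutSet b)
    then show ?thesis using assms(3,4) constants
      by (cases b) (simp_all add: perform_basic_def nat_cells)
  next
    case (AuxGet i)
    then show ?thesis using assms(3,4) constants content[of i] bounds(2)[of i]
      by (simp add: perform_basic_def nat_cells)
  next
    case (AuxSet i b)
    then show ?thesis using assms(3,4) constants
      by (cases b) (simp_all add: perform_basic_def nat_cells)
  qed
qed

lemma eval_dispatch_basic:
  assumes "loaded X m" "represents m s" "m FORM = 6 * int k + basic_form a" "k < 3"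
    and "m PARAM = basic_param a"
  shows "\<exists>m'. eval dispatch (m, io) = Some (m', io) \<and> loaded X m' \<and> represents m' (effect a s) \<and>
    m' POS = m POS + 4 * (if reply a s then if k = 2 then 2 else 1 else if k = 1 then 2 else 1) \<and>
    (\<forall>x\<le>RUNNING. m' x = m x)"
proof -
  have form_bounds: "0 \<le> basic_form a" "basic_form a < 6" by (cases a; simp)+
  let ?m = "m(TMP := m FORM - 17)"
  have "?m ONE = 1" using assms(1) by (simp add: loaded_def)
  then obtain m1 where decode: "eval decode_test (?m, io) = Some (m1, io)" "m1 FORM = basic_form a"
      "m1 ON_TRUE = (if k = 2 then 8 else 4)" "m1 ON_FALSE = (if k = 1 then 8 else 4)"
      "\<And>x. x \<le> POS \<or> x = PARAM \<or> OLDER < x \<Longrightarrow> m1 x = m x"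
    using eval_decode_test[of ?m k "basic_form a" io] assms(3,4) form_bounds by auto
  have loaded: "loaded X m1" by (rule loaded_cong[OF assms(1)]) (auto simp: decode(5))
  have represents: "represents m1 s" by (rule represents_cong[OF assms(2)]) (auto simp: decode(5))
  have "m1 PARAM = basic_param a" using decode(5) assms(5) by simp
  then obtain m' where perform: "eval perform_basic (m1, io) = Some (m', io)"
      "m' POS = m1 POS + (if reply a s then m1 ON_TRUE else m1 ON_FALSE)"
      "\<And>x. x \<le> RUNNING \<or> OLDER < x \<Longrightarrow> m' x = write_effect a m1 x"
    using eval_perform_basic[OF loaded represents decode(2)] by blast
  have frame: "\<forall>x\<le>RUNNING. m' x = m x"
    using perform(3) decode(5) by (simp add: write_effect_below)
  then have "m' ONE = 1" using assms(1) by (simp add: loaded_def)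
  then have "eval dispatch (m, io) = Some (m', io)"
    using decode(1) perform(1) assms(3,4) form_bounds by (simp add: dispatch_def)
  moreover have "loaded X m'"
    by (rule loaded_cong[OF loaded_write_effect[OF loaded]]) (auto simp: perform(3))
  moreover have "represents m' (effect a s)"
    by (rule represents_cong[OF represents_write_effect[OF represents]]) (auto simp: perform(3))
  ultimately show ?thesis
    using frame decode(3,4) perform(2) decode(5)[of POS] by auto
qed

lemma eval_dispatch_jump:
  assumes "loaded X m" "represents m s" "m FORM = prim_form (Jump l)" "m PARAM = int l" "l \<noteq> 0"
  shows "\<exists>m'. eval dispatch (m, io) = Some (m', io) \<and> loaded X m' \<and> represents m' s \<and>
    m' POS = m POS + 4 * int l \<and> (\<forall>x\<le>RUNNING. m' x = m x)"
proof -
  have "m ONE = 1" using assms(1) by (simp add: loaded_def)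
  then obtain m' where jump: "eval dispatch (m, io) = Some (m', io)" "m' POS = m POS + 4 * int l"
      "\<forall>x. x \<le> RUNNING \<or> OLDER < x \<longrightarrow> m' x = m x"
    using assms(3-5) by (simp add: dispatch_def jump_def)
  moreover have "loaded X m'" by (rule loaded_cong[OF assms(1)]) (use jump(3) in auto)
  moreover have "represents m' s" by (rule represents_cong[OF assms(2)]) (use jump(3) in auto)
  ultimately show ?thesis by blast
qed

lemma eval_dispatch_next:
  assumes "loaded X m" "represents m s" "m FORM = prim_form u" "m PARAM = prim_param u"
    and "u \<noteq> Term" "u \<noteq> Jump 0" "next_state u (p, s) = (p', s')"
  shows "\<exists>m'. eval dispatch (m, io) = Some (m', io) \<and> loaded X m' \<and> represents m' s' \<and>
    m' POS = m POS + 4 * (int p' - int p) \<and> (\<forall>x\<le>RUNNING. m' x = m x)"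
proof (cases u)
  case (Plain a)
  then show ?thesis using eval_dispatch_basic[OF assms(1,2), of 0 a io] assms(3,4,7) by auto
next
  case (PosTest a)
  then show ?thesis using eval_dispatch_basic[OF assms(1,2), of 1 a io] assms(3,4,7)
    by (auto split: if_splits)
next
  case (NegTest a)
  then show ?thesis using eval_dispatch_basic[OF assms(1,2), of 2 a io] assms(3,4,7)
    by (auto split: if_splits)
next
  case (Jump l)
  then show ?thesis using eval_dispatch_jump[OF assms(1,2), of l io] assms(3,4,6,7) by auto
qed (use assms(5) in simp)

definition represents_at :: "prim list \<Rightarrow> nat \<Rightarrow> store \<Rightarrow> (nat \<Rightarrow> int) \<Rightarrow> bool" where
  "represents_at X p s m \<longleftrightarrow> loaded X m \<and> represents m s \<and> m POS = 200 + 4 * int p"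

lemma eval_simulate_step_fetch:
  assumes "represents_at X p s m" "p < length X"
  shows "\<exists>m'. eval simulate_step (m, io) = eval dispatch (m', io) \<and> represents_at X p s m' \<and>
    m' FORM = prim_form (X ! p) \<and> m' PARAM = prim_param (X ! p) \<and>
    (\<forall>x. x \<le> RUNNING \<or> OLDER < x \<longrightarrow> m' x = m x)"
proof -
  have loaded: "loaded X m" and represents: "represents m s" and pos: "m POS = 200 + 4 * int p"
    using assms(1) by (simp_all add: represents_at_def)
  have "m ONE = 1" "m LIMIT = 200 + 4 * int (length X)"
      "m (200 + 4 * p) = prim_form (X ! p)" "m (201 + 4 * p) = prim_param (X ! p)"
    using loaded assms(2) unfolding loaded_def by simp_all
  moreover define m' where "m' = m(TMP := 4 * int (length X) - 4 * int p, FORM := prim_form (X ! p),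
    ADDR := 201 + 4 * int p, PARAM := prim_param (X ! p))"
  ultimately have "eval simulate_step (m, io) = eval dispatch (m', io)"
    using assms(2) pos by (simp add: simulate_step_def fetch_def nat_cells)
  moreover have "loaded X m'" by (rule loaded_cong[OF loaded]) (auto simp: m'_def)
  moreover have "represents m' s" by (rule represents_cong[OF represents]) (auto simp: m'_def)
  ultimately show ?thesis using pos by (intro exI[of _ m']) (auto simp: represents_at_def m'_def)
qed

lemma eval_simulate_step_next:
  assumes "represents_at X p s m" "p < length X" "X ! p \<noteq> Term" "X ! p \<noteq> Jump 0"
    and next_state: "next_state (X ! p) (p, s) = (p', s')"
  shows "\<exists>m'. eval simulate_step (m, io) = Some (m', io) \<and> represents_at X p' s' m' \<and>
    (\<forall>x\<le>RUNNING. m' x = m x)"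
proof -
  obtain m1 where fetch: "eval simulate_step (m, io) = eval dispatch (m1, io)"
      "represents_at X p s m1" "m1 FORM = prim_form (X ! p)" "m1 PARAM = prim_param (X ! p)"
      "\<And>x. x \<le> RUNNING \<Longrightarrow> m1 x = m x"
    using eval_simulate_step_fetch[OF assms(1,2)] by blast
  have "loaded X m1" "represents m1 s" using fetch(2) by (simp_all add: represents_at_def)
  from eval_dispatch_next[OF this fetch(3,4) assms(3-5), of io] show ?thesis
    using fetch(1,2,5) by (auto simp: represents_at_def)
qed

definition outcome :: "prim list \<Rightarrow> nat \<Rightarrow> store \<Rightarrow> int" where
  "outcome X p s = (if yields X p s True then 1 else if yields X p s False then - 1 else 0)"

lemma outcome_pos_iff: "0 < outcome X p s \<longleftrightarrow> yields X p s True"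
  by (simp add: outcome_def)

lemma outcome_neg_iff: "outcome X p s < 0 \<longleftrightarrow> yields X p s False"
  using not_yields_both by (auto simp: outcome_def)

lemma outcome_next:
  "p < length X \<Longrightarrow> X ! p \<noteq> Term \<Longrightarrow> next_state (X ! p) (p, s) = (p', s') \<Longrightarrow>
    outcome X p' s' = outcome X p s"
  by (simp add: outcome_def yields_next_iff)

lemma eval_simulate_step_halt:
  assumes "represents_at X p s m" "length X \<le> p \<or> X ! p = Term \<or> X ! p = Jump 0" "m RESULT = 0"
  shows "\<exists>m'. eval simulate_step (m, io) = Some (m', io) \<and> loaded X m' \<and>
    m' RUNNING = 0 \<and> m' RESULT = outcome X p s \<and> (\<forall>x\<le>STAMP. m' x = m x)"
proof -
  have "\<exists>m'. eval simulate_step (m, io) = Some (m', io) \<and>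
    m' RUNNING = 0 \<and> m' RESULT = outcome X p s \<and> (\<forall>x. x \<le> STAMP \<or> OLDER < x \<longrightarrow> m' x = m x)"
  proof (cases "p < length X")
    case False
    then have "outcome X p s = 0" by (auto simp: outcome_def dest: yields_length)
    then show ?thesis using assms False
      by (simp add: simulate_step_def represents_at_def loaded_def)
  next
    case True
    obtain m1 where fetch: "eval simulate_step (m, io) = eval dispatch (m1, io)"
        "represents_at X p s m1" "m1 FORM = prim_form (X ! p)" "m1 PARAM = prim_param (X ! p)"
        "\<And>x. x \<le> RUNNING \<or> OLDER < x \<Longrightarrow> m1 x = m x"
      using eval_simulate_step_fetch[OF assms(1) True] by blast
    have constants: "m1 ONE = 1" "m1 RESULT = 0"
      using fetch(2,5) assms(3) by (simp_all add: represents_at_def loaded_def)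
    consider "X ! p = Term" | "X ! p = Jump 0" using assms(2) True by linarith
    then show ?thesis
    proof cases
      case 1
      have "m1 (reg_cell OutReg) \<le> m1 STAMP" "s OutReg \<longleftrightarrow> m1 (reg_cell OutReg) = m1 STAMP"
        using fetch(2) unfolding represents_at_def represents_def loaded_def by blast+
      moreover have "outcome X p s = (if s OutReg then 1 else - 1)"
        using 1 True by (simp add: outcome_def yields_Term_iff)
      ultimately show ?thesis using fetch constants 1
        by (cases "s OutReg") (simp_all add: dispatch_def terminate_def)
    next
      case 2
      have "outcome X p s = 0" using 2 exec_not_Jump_0 by (auto simp: outcome_def yields_def)
      then show ?thesis using fetch constants 2 by (simp add: dispatch_def jump_def)
    qed
  qed
  then show ?thesis using assms(1) loaded_cong by (fastforce simp: represents_at_def)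
qed

lemma eval_set_up:
  assumes "loaded X m" "m INDEX = int i" "m SECOND = int c"
  shows "\<exists>m'. eval set_up (m, io) = Some (m', io) \<and>
    represents_at X 0 (input_store ({i, c} - {0})) m' \<and>
    m' RUNNING = 1 \<and> m' RESULT = 0 \<and> (\<forall>x\<le>SECOND. m' x = m x)"
proof -
  have "m ONE = 1" using assms(1) by (simp add: loaded_def)
  then have "\<exists>m'. eval set_up (m, io) = Some (m', io) \<and> m' STAMP = m STAMP + 1 \<and> m' POS = 200 \<and>
    m' RUNNING = 1 \<and> m' RESULT = 0 \<and> (\<forall>x. x \<le> SECOND \<or> OLDER < x \<longrightarrow>
      m' x = (if x = 202 then 0
        else if x = 202 + 4 * i \<or> x = 202 + 4 * c then m STAMP + 1 else m x))"
    using assms(2,3) by (simp add: set_up_def nat_cells)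
  then obtain m' where set_up: "eval set_up (m, io) = Some (m', io)" "m' STAMP = m STAMP + 1"
      "m' POS = 200" "m' RUNNING = 1" "m' RESULT = 0"
    and m': "\<And>x. x \<le> SECOND \<or> OLDER < x \<Longrightarrow>
      m' x = (if x = 202 then 0
        else if x = 202 + 4 * i \<or> x = 202 + 4 * c then m STAMP + 1 else m x)"
    by blast
  have regs: "m' (reg_cell r) = (if r = InReg 0 then 0
      else if r = InReg i \<or> r = InReg c then m STAMP + 1 else m (reg_cell r))" for r
    using reg_cell_inject[of r "InReg 0"] reg_cell_inject[of r "InReg i"]
      reg_cell_inject[of r "InReg c"]
    by (simp add: m' del: reg_cell_inject)
  have bounds: "0 \<le> m STAMP" "m (reg_cell r) \<le> m STAMP" for r
    using assms(1) by (simp_all add: loaded_def)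
  have code: "m' (200 + 4 * p) = m (200 + 4 * p)" "m' (201 + 4 * p) = m (201 + 4 * p)" for p
    by (simp_all add: m', presburger+)
  have "m' (reg_cell r) \<le> m' STAMP" for r
    using bounds(1) bounds(2)[of r] by (simp add: regs set_up(2))
  then have "loaded X m'"
    using assms(1) by (simp add: loaded_def set_up(2) code m')
  moreover have "input_store ({i, c} - {0}) r \<longleftrightarrow> m' (reg_cell r) = m' STAMP" for r
    using bounds(1) bounds(2)[of r]
    by (cases r) (auto simp: regs set_up(2) simp del: reg_cell.simps)
  then have "represents m' (input_store ({i, c} - {0}))"
    using bounds(1) by (simp add: represents_def set_up(2))
  ultimately show ?thesis
    using set_up by (intro exI[of _ m']) (simp add: represents_at_def m')
qed

definition simulating :: "prim list \<Rightarrow> int \<Rightarrow> nat \<Rightarrow> (nat \<Rightarrow> int) \<Rightarrow> bool" where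
  "simulating X y v m \<longleftrightarrow> loaded X m \<and>
     (m RUNNING = 1 \<and> m RESULT = 0 \<and>
        (\<exists>p s. represents_at X p s m \<and> outcome X p s = y \<and> v = length X - p + 1) \<or>
      m RUNNING = 0 \<and> m RESULT = y \<and> v = 0)"

lemma eval_simulate_step:
  assumes "simulating X y v m" "0 < m RUNNING"
  shows "\<exists>m' w. eval simulate_step (m, io) = Some (m', io) \<and> simulating X y w m' \<and> w < v \<and>
    (\<forall>x\<le>SECOND. m' x = m x)"
proof -
  obtain p s where at: "represents_at X p s m" "m RESULT = 0" "m RUNNING = 1"
      "outcome X p s = y" "v = length X - p + 1"
    using assms by (auto simp: simulating_def)
  show ?thesis
  proof (cases "length X \<le> p \<or> X ! p = Term \<or> X ! p = Jump 0")
    case True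
    from eval_simulate_step_halt[OF at(1) True at(2), of io] at(4,5) show ?thesis
      by (fastforce simp: simulating_def)
  next
    case False
    then have p: "p < length X" "X ! p \<noteq> Term" "X ! p \<noteq> Jump 0" by auto
    obtain p' s' where nxt: "next_state (X ! p) (p, s) = (p', s')" by (metis surj_pair)
    obtain m' where step: "eval simulate_step (m, io) = Some (m', io)"
        "represents_at X p' s' m'" "\<forall>x\<le>RUNNING. m' x = m x"
      using eval_simulate_step_next[OF at(1) p nxt] by blast
    have "simulating X y (length X - p' + 1) m'"
      using step(2,3) at(2-4) outcome_next[OF p(1,2) nxt]
      by (auto simp: simulating_def represents_at_def)
    moreover have "p < p'" using next_state_increases[OF p(2,3) nxt] .
    ultimately show ?thesis using step(1,3) at(5) p(1) by (intro exI[of _ m']) auto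
  qed
qed

definition simulate_time :: "nat \<Rightarrow> nat" where
  "simulate_time l = com_size set_up + (l + 1) * (com_size simulate_step + 2) + 2"

lemma runs_simulate:
  assumes "loaded X m" "m INDEX = int i" "m SECOND = int c"
  shows "\<exists>m'. runs simulate (m, io) (simulate_time (length X)) (m', io) \<and>
    loaded X m' \<and> m' RESULT = outcome X 0 (input_store ({i, c} - {0})) \<and> (\<forall>x\<le>SECOND. m' x = m x)"
proof -
  let ?y = "outcome X 0 (input_store ({i, c} - {0}))"
  obtain m1 where set_up: "eval set_up (m, io) = Some (m1, io)"
      "represents_at X 0 (input_store ({i, c} - {0})) m1" "m1 RUNNING = 1" "m1 RESULT = 0"
      "\<forall>x\<le>SECOND. m1 x = m x"
    using eval_set_up[OF assms] by blast
  define I where "I v m' \<longleftrightarrow> simulating X ?y v m' \<and> (\<forall>x\<le>SECOND. m' x = m x)" for v m'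
  have "\<exists>m' w. runs (WHILE RUNNING DO simulate_step) (m1, io)
      ((length X + 1) * (com_size simulate_step + 2) + 2) (m', io) \<and> I w m' \<and> m' RUNNING \<le> 0"
  proof (rule runs_While_mem)
    have "simulating X ?y (length X + 1) m1"
      using set_up unfolding simulating_def represents_at_def by (metis diff_zero)
    then show "I (length X + 1) m1" using set_up(5) by (simp add: I_def)
    show "0 < m' ONE" if "I v m'" for v m'
      using that by (auto simp: I_def simulating_def loaded_def)
    show "\<exists>m'' w. runs simulate_step (m', io) (com_size simulate_step) (m'', io) \<and> I w m'' \<and> w < v"
      if "I v m'" "0 < m' RUNNING" for v m'
      using that eval_simulate_step[of X ?y v m' io] runs_eval unfolding I_def by (metis (lifting))
  qed
  then obtain m2 w where loop: "runs (WHILE RUNNING DO simulate_step) (m1, io)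
      ((length X + 1) * (com_size simulate_step + 2) + 2) (m2, io)"
      "simulating X ?y w m2" "m2 RUNNING \<le> 0" "\<forall>x\<le>SECOND. m2 x = m x"
    by (auto simp: I_def)
  have "runs simulate (m, io) (simulate_time (length X)) (m2, io)"
    using runs_Seq[OF runs_eval[OF set_up(1)] loop(1)]
    by (simp add: simulate_def simulate_time_def add.assoc)
  then show ?thesis using loop(2-4) by (auto simp: simulating_def)
qed

subsection \<open>The tests\<close>

definition require_positive_result :: com where
  "require_positive_result = IF RESULT THEN Block [] ELSE Block [RConst PASSED 0]"

definition test_nonzero :: "nat \<Rightarrow> com" where
  "test_nonzero c = Block [RAdd SECOND c ZERO] ;; simulate ;; require_positive_result"

definition test_zero :: com where
  "test_zero =
     Block [RConst SECOND 0] ;; simulate ;;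
     Block [RSub RESULT ZERO RESULT] ;; require_positive_result"

definition test_index :: com where
  "test_index = test_nonzero ZERO ;; test_nonzero CRITICAL ;; Block [RSub INDEX INDEX ONE]"

definition run_tests :: com where
  "run_tests =
     Block [RConst PASSED 1, RAdd INDEX COUNT ZERO] ;;
     WHILE INDEX DO test_index ;;
     test_zero"

lemma eval_require_positive_result:
  assumes "loaded X m" "m PASSED = of_bool b"
  shows "\<exists>m'. eval require_positive_result (m, io) = Some (m', io) \<and> loaded X m' \<and>
    m' PASSED = of_bool (b \<and> 0 < m RESULT) \<and> (\<forall>x\<le>INDEX. m' x = m x)"
  using assms by (simp add: require_positive_result_def loaded_def)

lemma runs_test_nonzero:
  assumes "loaded X m" "m INDEX = int i" "m k = int c" "m PASSED = of_bool b"
  shows "\<exists>m'. runs (test_nonzero k) (m, io) (simulate_time (length X) + 4) (m', io) \<and> loaded X m' \<and>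
    m' PASSED = of_bool (b \<and> yields X 0 (input_store ({i, c} - {0})) True) \<and>
    (\<forall>x\<le>INDEX. m' x = m x)"
proof -
  let ?m = "m(SECOND := int c)"
  have "loaded X ?m" "?m INDEX = int i" "?m SECOND = int c"
    using assms(1,2) by (simp_all add: loaded_def)
  then obtain m1 where simulate: "runs simulate (?m, io) (simulate_time (length X)) (m1, io)"
      "loaded X m1" "m1 RESULT = outcome X 0 (input_store ({i, c} - {0}))" "\<forall>x\<le>SECOND. m1 x = ?m x"
    using runs_simulate by blast
  have "m1 PASSED = of_bool b" using simulate(4) assms(4) by simp
  then obtain m' where require: "eval require_positive_result (m1, io) = Some (m', io)"
      "loaded X m'" "m' PASSED = of_bool (b \<and> 0 < m1 RESULT)" "\<forall>x\<le>INDEX. m' x = m1 x"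
    using eval_require_positive_result[OF simulate(2)] by blast
  have "eval (Block [RAdd SECOND k ZERO]) (m, io) = Some (?m, io)"
    using assms(1,3) by (simp add: loaded_def)
  from runs_Seq[OF runs_eval[OF this] runs_Seq[OF simulate(1) runs_eval[OF require(1)]]]
  have "runs (test_nonzero k) (m, io) (simulate_time (length X) + 4) (m', io)"
    unfolding test_nonzero_def by (rule runs_mono) (simp add: require_positive_result_def)
  then show ?thesis using require simulate(3,4) by (auto simp: outcome_pos_iff)
qed

lemma runs_test_zero:
  assumes "loaded X m" "m INDEX = 0" "m PASSED = of_bool b"
  shows "\<exists>m'. runs test_zero (m, io) (simulate_time (length X) + 5) (m', io) \<and>
    m' PASSED = of_bool (b \<and> yields X 0 (input_store {}) False)"
proof -
  let ?m = "m(SECOND := 0)"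
  have "loaded X ?m" "?m INDEX = int 0" "?m SECOND = int 0"
    using assms(1,2) by (simp_all add: loaded_def)
  then obtain m1 where simulate: "runs simulate (?m, io) (simulate_time (length X)) (m1, io)"
      "loaded X m1" "m1 RESULT = outcome X 0 (input_store ({0, 0} - {0}))" "\<forall>x\<le>SECOND. m1 x = ?m x"
    using runs_simulate by blast
  let ?m1 = "m1(RESULT := - m1 RESULT)"
  have "loaded X ?m1" by (rule loaded_cong[OF simulate(2)]) auto
  moreover have "?m1 PASSED = of_bool b" using simulate(4) assms(3) by simp
  ultimately obtain m' where require: "eval require_positive_result (?m1, io) = Some (m', io)"
      "m' PASSED = of_bool (b \<and> 0 < ?m1 RESULT)"
    using eval_require_positive_result by blast
  have blocks: "eval (Block [RConst SECOND 0]) (m, io) = Some (?m, io)"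
      "eval (Block [RSub RESULT ZERO RESULT]) (m1, io) = Some (?m1, io)"
    using simulate(2) by (simp_all add: loaded_def)
  from runs_Seq[OF runs_eval[OF blocks(1)] runs_Seq[OF simulate(1)
      runs_Seq[OF runs_eval[OF blocks(2)] runs_eval[OF require(1)]]]]
  have "runs test_zero (m, io) (simulate_time (length X) + 5) (m', io)"
    unfolding test_zero_def by (rule runs_mono) (simp add: require_positive_result_def)
  then show ?thesis using require(2) simulate(3) by (auto simp: outcome_neg_iff)
qed

lemma runs_test_index:
  assumes "loaded X m" "m INDEX = int (Suc i)" "m PASSED = of_bool b"
  shows "\<exists>m'. runs test_index (m, io) (2 * simulate_time (length X) + 9) (m', io) \<and> loaded X m' \<and>
    m' INDEX = int i \<and> m' PASSED = of_bool (b \<and> passes_at X (Suc i))"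
proof -
  let ?i = "Suc i" and ?t = "simulate_time (length X)"
  have "m ZERO = int 0" using assms(1) by (simp add: loaded_def)
  from runs_test_nonzero[OF assms(1,2) this assms(3), of io] obtain m1
    where unit: "runs (test_nonzero ZERO) (m, io) (?t + 4) (m1, io)" "loaded X m1"
      "m1 PASSED = of_bool (b \<and> yields X 0 (input_store ({?i, 0} - {0})) True)"
      "\<forall>x\<le>INDEX. m1 x = m x"
    by blast
  have "m1 INDEX = int ?i" "m1 CRITICAL = int (critical_input X)"
    using unit(2,4) assms(2) by (simp_all add: loaded_def)
  from runs_test_nonzero[OF unit(2) this unit(3), of io] obtain m2
    where pair: "runs (test_nonzero CRITICAL) (m1, io) (?t + 4) (m2, io)" "loaded X m2"
      "m2 PASSED = of_bool (b \<and> passes_at X ?i)" "\<forall>x\<le>INDEX. m2 x = m1 x"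
    unfolding passes_at_def by (auto simp: conj_assoc)
  let ?m' = "m2(INDEX := int i)"
  have "eval (Block [RSub INDEX INDEX ONE]) (m2, io) = Some (?m', io)"
    using pair(2,4) unit(4) assms(2) by (simp add: loaded_def)
  from runs_Seq[OF unit(1) runs_Seq[OF pair(1) runs_eval[OF this]]]
  have "runs test_index (m, io) (2 * ?t + 9) (?m', io)"
    unfolding test_index_def by (rule runs_mono) simp
  moreover have "loaded X ?m'" using pair(2) by (simp add: loaded_def)
  ultimately show ?thesis using pair(3) by (intro exI[of _ ?m']) simp
qed

lemma runs_run_tests:
  assumes "loaded X m" "m COUNT = int n"
  shows "\<exists>m'. runs run_tests (m, io) ((2 * n + 1) * (simulate_time (length X) + 6) + 4) (m', io) \<and>
    m' PASSED = of_bool (passes X n)"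
proof -
  let ?t = "simulate_time (length X)" and ?m = "m(PASSED := 1, INDEX := int n)"
  define I where "I v m' \<longleftrightarrow> loaded X m' \<and> v \<le> n \<and> m' INDEX = int v \<and>
    m' PASSED = of_bool (\<forall>i\<in>{v<..n}. passes_at X i)" for v and m' :: "nat \<Rightarrow> int"
  have "\<exists>m' w. runs (WHILE INDEX DO test_index) (?m, io) (n * ((2 * ?t + 9) + 2) + 2) (m', io) \<and>
      I w m' \<and> m' INDEX \<le> 0"
  proof (rule runs_While_mem)
    show "I n ?m" using assms(1) by (simp add: I_def loaded_def)
    show "0 < m' ONE" if "I v m'" for v m'
      using that by (simp add: I_def loaded_def)
    fix v m' assume inv: "I v m'" and "0 < m' INDEX"
    then obtain w where v: "v = Suc w" "v \<le> n" by (cases v) (auto simp: I_def)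
    then obtain m'' where "runs test_index (m', io) (2 * ?t + 9) (m'', io)" "loaded X m''"
        "m'' INDEX = int w" "m'' PASSED = of_bool ((\<forall>i\<in>{v<..n}. passes_at X i) \<and> passes_at X v)"
      using runs_test_index[of X m' w "\<forall>i\<in>{v<..n}. passes_at X i" io] inv by (auto simp: I_def)
    moreover have "{w<..n} = insert v {v<..n}" using v by auto
    ultimately show "\<exists>m'' w. runs test_index (m', io) (2 * ?t + 9) (m'', io) \<and> I w m'' \<and> w < v"
      using v by (intro exI[of _ m''] exI[of _ w]) (auto simp: I_def)
  qed
  then obtain m1 where loop:
      "runs (WHILE INDEX DO test_index) (?m, io) (n * ((2 * ?t + 9) + 2) + 2) (m1, io)"
      "loaded X m1" "m1 INDEX = 0" "m1 PASSED = of_bool (\<forall>i\<in>{1..n}. passes_at X i)"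
    by (auto simp: I_def atLeastSucAtMost_greaterThanAtMost)
  obtain m2 where zero: "runs test_zero (m1, io) (?t + 5) (m2, io)"
      "m2 PASSED = of_bool ((\<forall>i\<in>{1..n}. passes_at X i) \<and> yields X 0 (input_store {}) False)"
    using runs_test_zero[OF loop(2-4)] by blast
  have "eval (Block [RConst PASSED 1, RAdd INDEX COUNT ZERO]) (m, io) = Some (?m, io)"
    using assms by (simp add: loaded_def)
  from runs_Seq[OF runs_eval[OF this] runs_Seq[OF loop(1) zero(1)]]
  have "runs run_tests (m, io) ((2 * n + 1) * (?t + 6) + 4) (m2, io)"
    unfolding run_tests_def by (rule runs_mono) (simp add: algebra_simps)
  moreover have "m2 PASSED = of_bool (passes X n)"
    using zero(2) by (simp add: passes_def conj_commute)
  ultimately show ?thesis by blast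
qed

subsection \<open>Reading the input\<close>

definition limit_step :: com where
  "limit_step = Block [RAdd LIMIT LIMIT POS, RSub TMP TMP ONE, RSub TMP TMP ONE]"

definition compute_limit :: com where
  "compute_limit =
     Block [RConst ONE 1, RRead COUNT, RAdd LIMIT COUNT COUNT, RAdd LIMIT LIMIT LIMIT,
       RConst TMP 204, RAdd LIMIT LIMIT TMP, RAdd TMP COUNT ZERO, RConst POS 4] ;;
     WHILE TMP DO limit_step"

definition read_instruction :: com where
  "read_instruction =
     Block [RRead FORM, RRead PARAM, RStore POS FORM, RAdd ADDR POS ONE, RStore ADDR PARAM,
       RConst TMP 4, RAdd POS POS TMP,
       RAdd OLDER PREVIOUS ZERO, RConst PREVIOUS 0, RConst TMP 6, RSub TMP FORM TMP] ;;
     IF TMP THEN Block []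
     ELSE
       (Block [RConst TMP 5, RSub TMP FORM TMP] ;;
        IF TMP THEN
          IF OLDER THEN Block [RAdd CRITICAL OLDER ZERO] ELSE Block [] ;;
          Block [RAdd PREVIOUS PARAM ZERO]
        ELSE Block []) ;;
     Block [RSub TMP LIMIT POS]"

definition read_sequence :: com where
  "read_sequence =
     Block [RConst POS 200, RSub TMP LIMIT POS] ;;
     WHILE TMP DO read_instruction"

lemma runs_limit_loop:
  assumes "m ONE = 1" "m COUNT = int n" "m POS = 4" "m TMP = int n" "m LIMIT = 204 + 4 * int n"
  shows "\<exists>m'. runs (WHILE TMP DO limit_step) (m, io) (5 * ((n + 1) div 2) + 2) (m', io) \<and>
    m' LIMIT = 200 + 4 * int (L n) \<and> (\<forall>x. x \<notin> {LIMIT, TMP} \<longrightarrow> m' x = m x)"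
proof -
  let ?half = "(n + 1) div 2"
  define I where "I v m' \<longleftrightarrow> v \<le> ?half \<and> m' TMP = int n - 2 * (int ?half - int v) \<and>
    m' LIMIT = 204 + 4 * int n + 4 * (int ?half - int v) \<and> (\<forall>x. x \<notin> {LIMIT, TMP} \<longrightarrow> m' x = m x)"
    for v and m' :: "nat \<Rightarrow> int"
  have "\<exists>m' w. runs (WHILE TMP DO limit_step) (m, io) (?half * (3 + 2) + 2) (m', io) \<and> I w m' \<and>
      m' TMP \<le> 0"
  proof (rule runs_While_mem)
    show "I ?half m" using assms by (simp add: I_def)
    show "0 < m' ONE" if "I v m'" for v m' using that assms(1) by (simp add: I_def)
    fix v m' assume inv: "I v m'" "0 < m' TMP"
    then obtain w where v: "v = Suc w" by (cases v) (auto simp: I_def)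
    let ?m = "m'(LIMIT := m' LIMIT + 4, TMP := m' TMP - 2)"
    have "m' ONE = 1" "m' POS = 4" using inv(1) assms(1,3) by (simp_all add: I_def)
    then have "eval limit_step (m', io) = Some (?m, io)" by (simp add: limit_step_def)
    from runs_eval[OF this] have "runs limit_step (m', io) 3 (?m, io)"
      by (rule runs_mono) (simp add: limit_step_def)
    moreover have "I w ?m" using inv v by (auto simp: I_def)
    ultimately show "\<exists>m'' w. runs limit_step (m', io) 3 (m'', io) \<and> I w m'' \<and> w < v"
      using v by blast
  qed
  then obtain m' w where loop:
      "runs (WHILE TMP DO limit_step) (m, io) (?half * (3 + 2) + 2) (m', io)" "I w m'" "m' TMP \<le> 0"
    by blast
  have "w = 0" using loop(2,3) by (auto simp: I_def)
  then show ?thesis using loop(1,2) by (auto simp: I_def L_eq mult.commute)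
qed

lemma runs_compute_limit:
  "\<exists>m. runs compute_limit (\<lambda>_. 0, int n # xs, ys) (5 * ((n + 1) div 2) + 10) (m, xs, ys) \<and>
    m ONE = 1 \<and> m COUNT = int n \<and> m LIMIT = 200 + 4 * int (L n) \<and>
    (\<forall>x. x \<notin> {ONE, COUNT, LIMIT, POS, TMP} \<longrightarrow> m x = 0)"
proof -
  let ?m = "(\<lambda>_. 0)(ONE := 1, COUNT := int n, LIMIT := 204 + 4 * int n, TMP := int n, POS := 4)"
  have init: "eval (Block [RConst ONE 1, RRead COUNT, RAdd LIMIT COUNT COUNT,
      RAdd LIMIT LIMIT LIMIT, RConst TMP 204, RAdd LIMIT LIMIT TMP, RAdd TMP COUNT ZERO,
      RConst POS 4]) (\<lambda>_. 0, int n # xs, ys) = Some (?m, xs, ys)"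
    by (simp add: fun_eq_iff)
  obtain m where loop:
      "runs (WHILE TMP DO limit_step) (?m, xs, ys) (5 * ((n + 1) div 2) + 2) (m, xs, ys)"
      "m LIMIT = 200 + 4 * int (L n)" "\<forall>x. x \<notin> {LIMIT, TMP} \<longrightarrow> m x = ?m x"
    using runs_limit_loop[of ?m n "(xs, ys)"] by auto
  from runs_Seq[OF runs_eval[OF init] loop(1)]
  have "runs compute_limit (\<lambda>_. 0, int n # xs, ys) (5 * ((n + 1) div 2) + 10) (m, xs, ys)"
    unfolding compute_limit_def by (rule runs_mono) simp
  then show ?thesis using loop(2,3) by auto
qed

lemma eval_read_instruction:
  assumes "m ZERO = 0" "m ONE = 1" "m POS = 200 + 4 * int p" "0 \<le> m PREVIOUS"
  shows "\<exists>m'. eval read_instruction (m, f # a # xs, ys) = Some (m', xs, ys) \<and>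
    m' POS = 204 + 4 * int p \<and> m' TMP = m LIMIT - (204 + 4 * int p) \<and>
    m' PREVIOUS = (if f = 6 then a else 0) \<and>
    m' CRITICAL = (if f = 6 \<and> m PREVIOUS \<noteq> 0 then m PREVIOUS else m CRITICAL) \<and>
    m' (200 + 4 * p) = f \<and> m' (201 + 4 * p) = a \<and>
    (\<forall>x. x \<notin> {CRITICAL, 200 + 4 * p, 201 + 4 * p} \<and> (x < RESULT \<or> OLDER < x) \<longrightarrow> m' x = m x)"
proof -
  consider "f < 6" | "6 < f" | "f = 6" "m PREVIOUS = 0" | "f = 6" "0 < m PREVIOUS"
    using assms(4) by linarith
  then show ?thesis
    by cases (use assms in \<open>simp_all add: read_instruction_def nat_cells\<close>)
qed

definition encode_prims :: "prim list \<Rightarrow> int list" where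
  "encode_prims us = concat (map (\<lambda>u. [prim_form u, prim_param u]) us)"

lemma prim_form_eq_6_iff: "prim_form u = 6 \<longleftrightarrow> (\<exists>i. u = PosTest (InGet i))"
proof (cases u)
  case (Plain a) then show ?thesis by (cases a) simp_all
next
  case (PosTest a) then show ?thesis by (cases a) simp_all
next
  case (NegTest a) then show ?thesis by (cases a) simp_all
qed simp_all

lemma last_test_pair_other:
  "prim_form u \<noteq> 6 \<Longrightarrow> last_test_pair c d (u # us) = last_test_pair c 0 us"
  by (cases "(c, d, u # us)" rule: last_test_pair.cases) auto

lemma ex_last_test_pair_Cons:
  "\<exists>c' d'. last_test_pair c' d' us = last_test_pair c d (u # us) \<and>
    int c' = (if prim_form u = 6 \<and> d \<noteq> 0 then int d else int c) \<and>
    int d' = (if prim_form u = 6 then prim_param u else 0)"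
proof (cases "prim_form u = 6")
  case True
  then obtain j where "u = PosTest (InGet j)" by (auto simp: prim_form_eq_6_iff)
  then show ?thesis by (intro exI[of _ "if d = 0 then c else d"] exI[of _ j]) auto
next
  case False
  then show ?thesis by (intro exI[of _ c] exI[of _ 0]) (simp add: last_test_pair_other)
qed

definition loading :: "nat \<Rightarrow> prim list \<Rightarrow> nat \<Rightarrow> (nat \<Rightarrow> int) \<Rightarrow> bool" where
  "loading n X p m \<longleftrightarrow> p \<le> length X \<and> m ZERO = 0 \<and> m ONE = 1 \<and> m COUNT = int n \<and>
     m LIMIT = 200 + 4 * int (length X) \<and> m POS = 200 + 4 * int p \<and> m TMP = 4 * int (length X - p) \<and>
     (\<exists>c d. m CRITICAL = int c \<and> m PREVIOUS = int d \<and>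
        last_test_pair c d (drop p X) = critical_input X) \<and>
     (\<forall>q<p. m (200 + 4 * q) = prim_form (X ! q) \<and> m (201 + 4 * q) = prim_param (X ! q)) \<and>
     m STAMP = 0 \<and> (\<forall>r. m (reg_cell r) = 0)"

lemma eval_read_instruction_loading:
  assumes "loading n X p m" "p < length X"
  shows "\<exists>m'. eval read_instruction (m, encode_prims (drop p X), ys) =
      Some (m', encode_prims (drop (p + 1) X), ys) \<and> loading n X (p + 1) m'"
proof -
  let ?f = "prim_form (X ! p)" and ?a = "prim_param (X ! p)" and ?us = "drop (p + 1) X"
  have drop_eq: "drop p X = X ! p # ?us" using assms(2) by (simp add: Cons_nth_drop_Suc)
  obtain c d where cd: "m CRITICAL = int c" "m PREVIOUS = int d"
      "last_test_pair c d (drop p X) = critical_input X"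
    using assms(1) by (auto simp: loading_def)
  have "m ZERO = 0" "m ONE = 1" "m POS = 200 + 4 * int p" "0 \<le> m PREVIOUS"
    using assms(1) by (auto simp: loading_def)
  from eval_read_instruction[OF this, of ?f ?a "encode_prims ?us" ys]
  obtain m' where read: "eval read_instruction (m, encode_prims (drop p X), ys) =
        Some (m', encode_prims ?us, ys)"
      "m' POS = 204 + 4 * int p" "m' TMP = m LIMIT - (204 + 4 * int p)"
      "m' PREVIOUS = (if ?f = 6 then ?a else 0)"
      "m' CRITICAL = (if ?f = 6 \<and> m PREVIOUS \<noteq> 0 then m PREVIOUS else m CRITICAL)"
      "m' (200 + 4 * p) = ?f" "m' (201 + 4 * p) = ?a"
    and unchanged: "\<And>x. x \<notin> {CRITICAL, 200 + 4 * p, 201 + 4 * p} \<Longrightarrow> x < RESULT \<or> OLDER < x \<Longrightarrow>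
      m' x = m x"
    unfolding drop_eq encode_prims_def by auto
  obtain c' d' where c'd': "last_test_pair c' d' ?us = critical_input X"
      "int c' = (if ?f = 6 \<and> d \<noteq> 0 then int d else int c)" "int d' = (if ?f = 6 then ?a else 0)"
    using ex_last_test_pair_Cons[of ?us c d "X ! p"] cd(3) drop_eq by auto
  then have "m' CRITICAL = int c'" "m' PREVIOUS = int d'" using read(4,5) cd(1,2) by simp_all
  moreover have "m' (200 + 4 * q) = prim_form (X ! q) \<and> m' (201 + 4 * q) = prim_param (X ! q)"
    if "q < p + 1" for q
  proof (cases "q = p")
    case False
    then have "q < p" "200 + 4 * q \<noteq> 201 + 4 * p" "201 + 4 * q \<noteq> 200 + 4 * p"
      using that by presburger+
    then show ?thesis using assms(1) by (simp add: unchanged loading_def)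
  qed (simp add: read(6,7))
  ultimately have "loading n X (p + 1) m'"
    using assms read(2,3) c'd'(1) unfolding loading_def by (auto simp: unchanged)
  then show ?thesis using read(1) by blast
qed

lemma runs_read_instructions:
  assumes "loading n X 0 m"
  shows "\<exists>m'. runs (WHILE TMP DO read_instruction) (m, encode_prims X, ys)
      (length X * (com_size read_instruction + 2) + 2) (m', [], ys) \<and> loading n X (length X) m'"
proof -
  define I where "I v s \<longleftrightarrow> (\<exists>m p. s = (m, encode_prims (drop p X), ys) \<and> loading n X p m \<and>
    v = length X - p)" for v and s :: state
  have "\<exists>s' w. runs (WHILE TMP DO read_instruction) (m, encode_prims X, ys)
      (length X * (com_size read_instruction + 2) + 2) s' \<and> I w s' \<and> fst s' TMP \<le> 0"
  proof (rule runs_While)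
    show "I (length X) (m, encode_prims X, ys)"
      using assms by (auto simp: I_def intro!: exI[of _ 0])
    show "0 < fst s ONE" if "I v s" for v s
      using that by (auto simp: I_def loading_def)
    fix v s assume "I v s" and "0 < fst s TMP"
    then obtain m p where p: "s = (m, encode_prims (drop p X), ys)" "loading n X p m"
        "v = length X - p" "p < length X"
      by (auto simp: I_def loading_def)
    obtain m' where step: "eval read_instruction s = Some (m', encode_prims (drop (p + 1) X), ys)"
        "loading n X (p + 1) m'"
      using eval_read_instruction_loading[OF p(2,4)] p(1) by blast
    have "I (length X - (p + 1)) (m', encode_prims (drop (p + 1) X), ys)"
      using step(2) by (auto simp: I_def)
    moreover have "length X - (p + 1) < v" using p(3,4) by simp
    ultimately show "\<exists>s' w. runs read_instruction s (com_size read_instruction) s' \<and> I w s' \<and> w < v"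
      using runs_eval[OF step(1)] by blast
  qed
  then obtain m' p where loop: "runs (WHILE TMP DO read_instruction) (m, encode_prims X, ys)
        (length X * (com_size read_instruction + 2) + 2) (m', encode_prims (drop p X), ys)"
      "loading n X p m'" "m' TMP \<le> 0"
    by (auto simp: I_def)
  have "p = length X" using loop(2,3) by (auto simp: loading_def)
  moreover have "encode_prims [] = []" by (simp add: encode_prims_def)
  ultimately show ?thesis using loop(1,2) by auto
qed

lemma runs_read_sequence:
  assumes "m ONE = 1" "m COUNT = int n" "m LIMIT = 200 + 4 * int (length X)"
    and "\<And>x. x \<notin> {ONE, COUNT, LIMIT, POS, TMP} \<Longrightarrow> m x = 0"
  shows "\<exists>m'. runs read_sequence (m, encode_prims X, ys)
      (length X * (com_size read_instruction + 2) + 4) (m', [], ys) \<and>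
    loaded X m' \<and> m' COUNT = int n"
proof -
  let ?m = "m(POS := 200, TMP := m LIMIT - 200)"
  have "loading n X 0 ?m" using assms by (auto simp: loading_def critical_input_def)
  then obtain m' where loop: "runs (WHILE TMP DO read_instruction) (?m, encode_prims X, ys)
        (length X * (com_size read_instruction + 2) + 2) (m', [], ys)" "loading n X (length X) m'"
    using runs_read_instructions by blast
  have "eval (Block [RConst POS 200, RSub TMP LIMIT POS]) (m, encode_prims X, ys) =
      Some (?m, encode_prims X, ys)"
    by simp
  from runs_Seq[OF runs_eval[OF this] loop(1)] have "runs read_sequence (m, encode_prims X, ys)
      (length X * (com_size read_instruction + 2) + 4) (m', [], ys)"
    unfolding read_sequence_def by (rule runs_mono) simp
  moreover have "loaded X m'" "m' COUNT = int n"
    using loop(2) by (auto simp: loading_def loaded_def)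
  ultimately show ?thesis by blast
qed

subsection \<open>The running time\<close>

definition decide :: com where
  "decide = compute_limit ;; read_sequence ;; run_tests ;; Block [RPrint PASSED]"

lemma L_le: "1 \<le> n \<Longrightarrow> L n \<le> 3 * n"
  by (simp add: L_eq)

lemma simulate_time_le:
  assumes "1 \<le> n"
  shows "simulate_time (L n) \<le> 422 * n"
proof -
  have "com_size set_up \<le> 20" "com_size simulate_step \<le> 98"
    by (simp_all add: simulate_step_def fetch_def dispatch_def terminate_def jump_def
        decode_test_def perform_basic_def set_up_def)
  then have "simulate_time (L n) \<le> 20 + (3 * n + 1) * (98 + 2) + 2"
    unfolding simulate_time_def using L_le[OF assms] by (intro add_mono mult_le_mono) simp_all
  also have "\<dots> \<le> 422 * n" using assms by simp
  finally show ?thesis .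
qed

lemma decision_time_le:
  assumes "1 \<le> n"
  shows "(5 * ((n + 1) div 2) + 10) + ((L n * (com_size read_instruction + 2) + 4) +
    (((2 * n + 1) * (simulate_time (L n) + 6) + 4) + 1)) \<le> 1500 * n\<^sup>2" (is "?time \<le> _")
proof -
  have "com_size read_instruction \<le> 40" by (simp add: read_instruction_def)
  then have "?time \<le> (5 * n + 10) + ((3 * n * 42 + 4) + ((3 * n * (422 * n + 6 * n) + 4) + 1))"
    using assms L_le simulate_time_le by (intro add_mono mult_le_mono) simp_all
  also have "\<dots> = 131 * n + 19 + 1284 * n\<^sup>2" by (simp add: power2_eq_square)
  also have "\<dots> \<le> 1500 * n\<^sup>2"
  proof -
    have "n * 1 \<le> n * n" using assms by (intro mult_le_mono2)
    then show ?thesis using assms unfolding power2_eq_square by linarith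
  qed
  finally show ?thesis .
qed

lemma runs_decide:
  assumes "1 \<le> n" "length X = L n"
  shows "\<exists>m. runs decide (\<lambda>_. 0, encode_input n X, []) (1500 * n\<^sup>2) (m, [], [of_bool (passes X n)])"
proof -
  let ?t = "simulate_time (L n)"
  obtain m1 where limit: "runs compute_limit (\<lambda>_. 0, encode_input n X, [])
        (5 * ((n + 1) div 2) + 10) (m1, encode_prims X, [])"
      "m1 ONE = 1" "m1 COUNT = int n" "m1 LIMIT = 200 + 4 * int (length X)"
      "\<And>x. x \<notin> {ONE, COUNT, LIMIT, POS, TMP} \<Longrightarrow> m1 x = 0"
    using runs_compute_limit[of n "encode_prims X" "[]"] assms(2)
    by (auto simp: encode_input_def encode_prims_def)
  obtain m2 where sequence: "runs read_sequence (m1, encode_prims X, [])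
        (L n * (com_size read_instruction + 2) + 4) (m2, [], [])" "loaded X m2" "m2 COUNT = int n"
    using runs_read_sequence[OF limit(2-5), of "[]"] assms(2) by auto
  obtain m3 where tests: "runs run_tests (m2, [], []) ((2 * n + 1) * (?t + 6) + 4) (m3, [], [])"
      "m3 PASSED = of_bool (passes X n)"
    using runs_run_tests[OF sequence(2,3), of "([], [])"] assms(2) by auto
  have print: "runs (Block [RPrint PASSED]) (m3, [], []) 1 (m3, [], [of_bool (passes X n)])"
    using runs_Block[of "[RPrint PASSED]" "(m3, [], [])"] tests(2) by simp
  from runs_Seq[OF limit(1) runs_Seq[OF sequence(1) runs_Seq[OF tests(1) print]]]
  have "runs decide (\<lambda>_. 0, encode_input n X, []) (1500 * n\<^sup>2) (m3, [], [of_bool (passes X n)])"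
    unfolding decide_def by (rule runs_mono) (rule decision_time_le[OF assms(1)])
  then show ?thesis by blast
qed

corollary decide_outputs:
  assumes "1 \<le> n" "length X = L n"
  shows "ram_outputs_in_time (compile decide 0) (encode_input n X) (1500 * n\<^sup>2)
    [of_bool (passes X n)]"
  using runs_decide[OF assms] runs_outputs by blast

theorem theorem5:
  "\<exists>(P :: ram_program) (T :: nat \<Rightarrow> nat).
     (\<lambda>n. real (T n)) \<in> O(\<lambda>n. (real n)\<^sup>2) \<and>
     (\<forall>n \<ge> 1. \<forall>X \<in> IS. length X = L n \<longrightarrow>
        ram_outputs_in_time P (encode_input n X) (T n)
          [if computes X n tstnz then 1 else 0])"
proof (intro exI conjI allI ballI impI)
  show "(\<lambda>n. real (1500 * n\<^sup>2)) \<in> O(\<lambda>n. (real n)\<^sup>2)" by simp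
  fix n X assume "1 \<le> n" "X \<in> IS" "length X = L n"
  then show "ram_outputs_in_time (compile decide 0) (encode_input n X) (1500 * n\<^sup>2)
      [if computes X n tstnz then 1 else 0]"
    using decide_outputs computes_tstnz_iff_passes by (simp add: of_bool_def)
qed

end
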